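(* Let $A$ be the set of primes $p$ with $p\equiv 2\pmod 3$ for which there exist $\alpha,\beta,\gamma\in\mathbb{N}=\{1,2,\dots\}$ and primes $q,r$ with $\gcd(6,qr)=1$ such that $p+1=2^\alpha3^\beta q$ and $p-1=2^\gamma r$. Let $A_{\le x}=\{p\in A:p\le x\}$ and $\mathfrak{S}_A=9\prod_{p\ge5\text{ prime}}(1-\frac3p)(1-\frac1p)^{-3}$. Then, without assuming any conjectures, $$\limsup_{x\to\infty}\frac{|A_{\le x}|}{x/(\log x)^3}\le 24\,\mathfrak{S}_A.$$
   Context: $\log$ denotes the natural logarithm. *)

theory Defs
  imports "HOL-Analysis.Analysis" "HOL-Computational_Algebra.Primes" "HOL-Number_Theory.Cong"
begin

definition set_A :: "nat set" where
  "set_A = {p. prime p \<and> [p = 2] (mod 3) \<and>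
     (\<exists>\<alpha> \<beta> \<gamma> q r :: nat. \<alpha> \<ge> 1 \<and> \<beta> \<ge> 1 \<and> \<gamma> \<ge> 1 \<and> prime q \<and> prime r \<and>
        gcd 6 (q * r) = 1 \<and> p + 1 = 2 ^ \<alpha> * 3 ^ \<beta> * q \<and> p - 1 = 2 ^ \<gamma> * r)}"

text \<open>
  The factors of the Euler product are \<open>1 + O(1 / p\<^sup>2)\<close> and nonzero for \<open>p \<ge> 5\<close>, so the
  product converges and \<^const>\<open>prodinf\<close> is its value.
\<close>
definition singular_series_A :: real where
  "singular_series_A =
     9 * (\<Prod>p. if prime p \<and> p \<ge> 5 then (1 - 3 / real p) * (1 - 1 / real p) powi (-3) else 1)"

end

theory Submission
  imports Defs "HOL-Number_Theory.Totient" "HOL-Real_Asymp.Real_Asymp"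
begin

text \<open>
  A single application of the Selberg sieve of dimension 3 covers all exponents
  \<open>\<alpha>, \<beta>, \<gamma>\<close> at once. An element \<open>p\<close> of \<open>set_A\<close> lies in the class \<open>5\<close> modulo \<open>6\<close>, and unless one of
  \<open>p, q, r\<close> is at most \<open>y = x\<^sup>\<theta>\<close>, which happens \<open>O(y log\<^sup>2 x)\<close> times, no prime \<open>l \<in> (4, y]\<close>
  divides \<open>p (p + 1) (p - 1)\<close>. Removing the classes \<open>0, 1, -1\<close> modulo these primes leaves at most
  \<open>x / (6 G(y)) + O(y\<^bsup>2+\<epsilon>\<^esup>)\<close> integers, where \<open>G(y)\<close> is the sum of \<open>\<Prod>\<^bsub>l | d\<^esub> 3 / (l - 3)\<close>
  over squarefree \<open>d \<le> y\<close> prime to \<open>6\<close>; this is admissible for every \<open>\<theta> < 1 / 2\<close>.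

  The sharp lower bound for \<open>G(y)\<close> needs no information on primes. The primes up to a fixed
  \<open>z\<close> split off as the finite Euler product of \<open>(1 - 3 / l)\<^sup>-\<^sup>1\<close>. What remains dominates the sum
  of \<open>1 / (a b c)\<close> over triples of integers without prime factor up to \<open>z\<close> and with
  \<open>a b c \<le> y / z!\<close>, because \<open>(1 - 1 / l)\<^sup>-\<^sup>3 \<le> (1 - 3 / l)\<^sup>-\<^sup>1\<close>, and this sum is asymptotically
  \<open>\<Prod>\<^bsub>l \<le> z\<^esub> (1 - 1 / l)\<^sup>3 (log y)\<^sup>3 / 6\<close>. Letting \<open>z\<close> grow and \<open>\<theta>\<close> tend to \<open>1 / 2\<close> gives the constant.
\<close>

section \<open>The Selberg sieve\<close>

text \<open>Writing \<open>D\<close> as \<open>S\<close> together with a subset of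
  \<open>T - S\<close> turns the sum, up to sign, into the expansion of 1 - 1 raised to the power
  \<open>card (T - S)\<close>. It serves as Moebius inversion on the lattice of subsets.\<close>

lemma sum_neg_one_card_between:
  assumes "finite T" "S \<subseteq> T"
  shows "(\<Sum>D | S \<subseteq> D \<and> D \<subseteq> T. (-1::real) ^ card D) = (if S = T then (-1) ^ card S else 0)"
proof -
  have "(\<Sum>D | S \<subseteq> D \<and> D \<subseteq> T. (-1::real) ^ card D)
      = (\<Sum>C \<in> Pow (T - S). (-1) ^ card S * (\<Prod>x\<in>C. (-1)))"
  proof (rule sum.reindex_bij_witness[of _ "\<lambda>C. S \<union> C" "\<lambda>D. D - S"])
    fix D assume "D \<in> {D. S \<subseteq> D \<and> D \<subseteq> T}"
    then have D: "S \<subseteq> D" "D \<subseteq> T" by auto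
    have "finite D" using D assms by (metis finite_subset)
    moreover have "finite S" using \<open>finite D\<close> D(1) by (rule rev_finite_subset)
    ultimately have "card (S \<union> (D - S)) = card S + card (D - S)" by (intro card_Un_disjoint) auto
    then have "card D = card S + card (D - S)" using D(1) by (simp add: Un_absorb1)
    then show "(-1::real) ^ card S * (\<Prod>x\<in>D - S. (-1)) = (-1) ^ card D"
      by (simp add: power_add)
  qed (use assms in auto)
  also have "\<dots> = (-1) ^ card S * (\<Prod>x\<in>T - S. (-1) + 1)"
    using assms by (subst prod_add) (auto simp: sum_distrib_left)
  also have "\<dots> = (if S = T then (-1) ^ card S else 0)"
    using assms by (auto simp: power_0_left card_gt_0_iff)
  finally show ?thesis .
qed

text \<open>Squarefree moduli appear as finite sets of primes, and the down-closed family
  \<open>F\<close> stands for the condition that the modulus is at most the level. The square of a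
  weighted sum over \<open>F\<close>, with weight 1 at the empty set, majorizes the indicator of the
  sifted elements, and the resulting quadratic form is diagonalized.\<close>

theorem selberg_upper_bound:
  fixes g :: "'a \<Rightarrow> real" and bad :: "'b \<Rightarrow> 'a set" and r :: "'a set \<Rightarrow> real"
  assumes P: "finite P" and g: "\<And>p. p \<in> P \<Longrightarrow> 0 < g p" "\<And>p. p \<in> P \<Longrightarrow> g p < 1"
    and F: "F \<subseteq> Pow P" "{} \<in> F" "\<And>S T. T \<in> F \<Longrightarrow> S \<subseteq> T \<Longrightarrow> S \<in> F"
    and N: "finite N"
    and r: "\<And>S. S \<subseteq> P \<Longrightarrow> \<bar>real (card {n \<in> N. S \<subseteq> bad n}) - X * prod g S\<bar> \<le> r S"
  shows "real (card {n \<in> N. bad n \<inter> P = {}})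
    \<le> X / (\<Sum>S\<in>F. \<Prod>p\<in>S. g p / (1 - g p))
       + (\<Sum>S\<in>F. \<Sum>T\<in>F. (\<Prod>p\<in>S. 1 / (1 - g p)) * (\<Prod>p\<in>T. 1 / (1 - g p)) * r (S \<union> T))"
proof -
  define h where "h S = (\<Prod>p\<in>S. g p / (1 - g p))" for S
  define G where "G = sum h F"
  define w where "w S = (\<Prod>p\<in>S. 1 / (1 - g p))" for S
  \<comment> \<open>Selberg's choice: these weights minimize the quadratic form evaluated in
    \<open>Q\<close> under the constraint \<open>\<Lambda> {} = 1\<close>.\<close>
  define \<Lambda> where "\<Lambda> S = (-1) ^ card S / (prod g S * G) * (\<Sum>T | T \<in> F \<and> S \<subseteq> T. h T)" for S
  have finF: "finite F" using P F(1) by (meson finite_Pow_iff finite_subset)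
  have fin: "finite S" if "S \<in> F" for S using that F(1) P finite_subset by blast
  have sub: "S \<subseteq> P" if "S \<in> F" for S using that F(1) by blast
  have hpos: "h S > 0" if "S \<subseteq> P" for S
    unfolding h_def using that g by (intro prod_pos) (auto simp: subset_iff)
  have gpos: "prod g S > 0" if "S \<subseteq> P" for S
    using that g by (intro prod_pos) auto
  have "h {} \<le> G" unfolding G_def
    using F finF sub by (intro member_le_sum) (auto intro!: less_imp_le[OF hpos])
  then have G1: "G \<ge> 1" by (simp add: h_def)
  have hw: "h S = w S * prod g S" for S
    by (simp add: h_def w_def prod_dividef)
  have \<Lambda>1: "\<Lambda> {} = 1" using G1 by (simp add: \<Lambda>_def G_def)
  \<comment> \<open>Each \<open>T\<close> containing \<open>S\<close> contributes
    \<open>h S * h (T - S)\<close>, and the sets \<open>T - S\<close> are distinct members of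
    \<open>F\<close>, so after extracting \<open>h S\<close> at most \<open>G\<close>
    remains.\<close>
  have \<Lambda>_bound: "\<bar>\<Lambda> S\<bar> \<le> w S" if S: "S \<in> F" for S
  proof -
    have "(\<Sum>T | T \<in> F \<and> S \<subseteq> T. h T) = (\<Sum>T | T \<in> F \<and> S \<subseteq> T. h S * h (T - S))"
      by (intro sum.cong) (auto simp: h_def prod.subset_diff fin mult.commute)
    also have "\<dots> = h S * (\<Sum>T | T \<in> F \<and> S \<subseteq> T. h (T - S))" by (simp add: sum_distrib_left)
    also have "(\<Sum>T | T \<in> F \<and> S \<subseteq> T. h (T - S)) = sum h ((\<lambda>T. T - S) ` {T. T \<in> F \<and> S \<subseteq> T})"
      by (subst sum.reindex) (auto simp: inj_on_def)
    also have "\<dots> \<le> G" unfolding G_def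
      using finF F(3) sub by (intro sum_mono2) (auto intro!: less_imp_le[OF hpos])
    finally have 1: "(\<Sum>T | T \<in> F \<and> S \<subseteq> T. h T) \<le> h S * G"
      using hpos[OF sub[OF S]] by (simp add: mult_left_mono)
    have 2: "0 \<le> (\<Sum>T | T \<in> F \<and> S \<subseteq> T. h T)"
      using hpos sub by (intro sum_nonneg) (auto intro!: less_imp_le[OF hpos])
    have "\<bar>\<Lambda> S\<bar> = (\<Sum>T | T \<in> F \<and> S \<subseteq> T. h T) / (prod g S * G)"
      using gpos[OF sub[OF S]] G1 2 by (simp add: \<Lambda>_def abs_mult power_abs)
    also have "\<dots> \<le> h S * G / (prod g S * G)"
      using 1 gpos[OF sub[OF S]] G1 by (intro divide_right_mono) auto
    also have "\<dots> = w S" using gpos[OF sub[OF S]] G1 by (simp add: hw)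
    finally show ?thesis .
  qed
  \<comment> \<open>Moebius inversion: these are the new variables, indexed by \<open>B\<close>, in
    which the quadratic form becomes a sum of squares.\<close>
  have inv: "(\<Sum>D | D \<in> F \<and> B \<subseteq> D. \<Lambda> D * prod g D) = (-1) ^ card B * h B / G" if B: "B \<in> F" for B
  proof -
    have "(\<Sum>D | D \<in> F \<and> B \<subseteq> D. \<Lambda> D * prod g D)
        = (\<Sum>D | D \<in> F \<and> B \<subseteq> D. \<Sum>T | T \<in> F \<and> D \<subseteq> T. (-1) ^ card D * h T / G)"
    proof (intro sum.cong refl)
      fix D assume "D \<in> {D. D \<in> F \<and> B \<subseteq> D}"
      then have "prod g D > 0" by (intro gpos sub) simp
      then have "\<Lambda> D * prod g D = (-1) ^ card D / G * (\<Sum>T | T \<in> F \<and> D \<subseteq> T. h T)"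
        by (simp add: \<Lambda>_def)
      then show "\<Lambda> D * prod g D = (\<Sum>T | T \<in> F \<and> D \<subseteq> T. (-1) ^ card D * h T / G)"
        by (simp add: sum_distrib_left)
    qed
    also have "\<dots> = (\<Sum>T | T \<in> F \<and> B \<subseteq> T. \<Sum>D | B \<subseteq> D \<and> D \<subseteq> T. (-1) ^ card D * h T / G)"
    proof -
      have "(\<Sum>D | D \<in> F \<and> B \<subseteq> D. \<Sum>T | T \<in> F \<and> D \<subseteq> T. (-1) ^ card D * h T / G)
         = (\<Sum>D\<in>F. \<Sum>T\<in>F. if B \<subseteq> D \<and> D \<subseteq> T then (-1) ^ card D * h T / G else 0)"
        unfolding sum.inter_filter[OF finF] by (intro sum.cong refl) auto
      also have "\<dots> = (\<Sum>T\<in>F. \<Sum>D\<in>F. if B \<subseteq> D \<and> D \<subseteq> T then (-1) ^ card D * h T / G else 0)"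
        by (rule sum.swap)
      also have "\<dots> = (\<Sum>T\<in>F. if B \<subseteq> T then \<Sum>D | B \<subseteq> D \<and> D \<subseteq> T. (-1) ^ card D * h T / G else 0)"
      proof (intro sum.cong refl)
        fix T assume T: "T \<in> F"
        have eq: "{D \<in> F. B \<subseteq> D \<and> D \<subseteq> T} = {D. B \<subseteq> D \<and> D \<subseteq> T}" using F(3) T by blast
        have "(\<Sum>D\<in>F. if B \<subseteq> D \<and> D \<subseteq> T then (-1) ^ card D * h T / G else 0)
            = (\<Sum>D | B \<subseteq> D \<and> D \<subseteq> T. (-1) ^ card D * h T / G)"
          unfolding eq[symmetric] by (rule sum.inter_filter[OF finF, symmetric])
        also have "\<dots> = (if B \<subseteq> T then \<Sum>D | B \<subseteq> D \<and> D \<subseteq> T. (-1) ^ card D * h T / G else 0)"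
        proof (cases "B \<subseteq> T")
          case False
          then have "{D. B \<subseteq> D \<and> D \<subseteq> T} = {}" by blast
          then show ?thesis using False by (simp only: sum.empty if_False)
        qed simp
        finally show "(\<Sum>D\<in>F. if B \<subseteq> D \<and> D \<subseteq> T then (-1) ^ card D * h T / G else 0)
          = (if B \<subseteq> T then \<Sum>D | B \<subseteq> D \<and> D \<subseteq> T. (-1) ^ card D * h T / G else 0)" .
      qed
      also have "\<dots> = (\<Sum>T | T \<in> F \<and> B \<subseteq> T. \<Sum>D | B \<subseteq> D \<and> D \<subseteq> T. (-1) ^ card D * h T / G)"
        using finF by (simp add: sum.inter_filter)
      finally show ?thesis .
    qed
    also have "\<dots> = (\<Sum>T | T \<in> F \<and> B \<subseteq> T. if B = T then (-1) ^ card B * h B / G else 0)"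
    proof (intro sum.cong refl)
      fix T assume "T \<in> {T. T \<in> F \<and> B \<subseteq> T}"
      then have "finite T" "B \<subseteq> T" using fin by auto
      have "(\<Sum>D | B \<subseteq> D \<and> D \<subseteq> T. (-1) ^ card D * h T / G)
          = (\<Sum>D | B \<subseteq> D \<and> D \<subseteq> T. (-1) ^ card D) * (h T / G)"
        by (simp only: sum_distrib_right sum_divide_distrib times_divide_eq_right)
      then show "(\<Sum>D | B \<subseteq> D \<and> D \<subseteq> T. (-1) ^ card D * h T / G)
          = (if B = T then (-1) ^ card B * h B / G else 0)"
        using sum_neg_one_card_between[OF \<open>finite T\<close> \<open>B \<subseteq> T\<close>] by auto
    qed
    also have "\<dots> = (-1) ^ card B * h B / G"
      using finF B by (subst sum.delta') auto
    finally show ?thesis .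
  qed
  \<comment> \<open>The left side is \<open>prod g S * prod g T / prod g (S \<inter> T)\<close>. At
    a single prime 1 / g = 1 + 1 / h, and multiplying this out over \<open>S \<inter> T\<close>
    gives the sum over \<open>B\<close>, which separates \<open>S\<close> from
    \<open>T\<close>.\<close>
  have g_Un: "prod g (S \<union> T) = (\<Sum>B\<in>F. if B \<subseteq> S \<and> B \<subseteq> T then prod g S * prod g T / h B else 0)"
    if S: "S \<in> F" and T: "T \<in> F" for S T
  proof -
    have *: "prod g (S \<union> T) * prod g (S \<inter> T) = prod g S * prod g T"
      using fin[OF S] fin[OF T] by (rule prod.union_inter)
    have "(\<Sum>B\<in>F. if B \<subseteq> S \<and> B \<subseteq> T then prod g S * prod g T / h B else 0)
        = (\<Sum>B\<in>Pow (S \<inter> T). prod g S * prod g T / h B)"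
    proof -
      have "{B \<in> F. B \<subseteq> S \<and> B \<subseteq> T} = Pow (S \<inter> T)" using F(3) S by blast
      then show ?thesis using finF by (simp add: sum.inter_filter[symmetric])
    qed
    also have "\<dots> = prod g S * prod g T * (\<Sum>B\<in>Pow (S \<inter> T). (\<Prod>p\<in>B. (1 - g p) / g p))"
      by (simp add: h_def sum_distrib_left prod_dividef divide_simps)
    also have "(\<Sum>B\<in>Pow (S \<inter> T). (\<Prod>p\<in>B. (1 - g p) / g p)) = (\<Prod>p\<in>S \<inter> T. (1 - g p) / g p + 1)"
      using fin[OF S] by (subst prod_add) auto
    also have "\<dots> = (\<Prod>p\<in>S \<inter> T. 1 / g p)"
    proof (intro prod.cong refl)
      fix p assume "p \<in> S \<inter> T"
      then have "g p > 0" using g sub[OF S] by auto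
      then show "(1 - g p) / g p + 1 = 1 / g p" by (simp add: field_simps)
    qed
    also have "\<dots> = 1 / prod g (S \<inter> T)" by (simp add: prod_dividef)
    also have "prod g S * prod g T * (1 / prod g (S \<inter> T)) = prod g (S \<union> T)"
      using gpos[of "S \<inter> T"] sub[OF S] by (simp add: *[symmetric] le_infI1)
    finally show ?thesis by simp
  qed
  have Q: "(\<Sum>S\<in>F. \<Sum>T\<in>F. \<Lambda> S * \<Lambda> T * prod g (S \<union> T)) = 1 / G"
  proof -
    define a where "a S = \<Lambda> S * prod g S" for S
    have "(\<Sum>S\<in>F. \<Sum>T\<in>F. \<Lambda> S * \<Lambda> T * prod g (S \<union> T))
        = (\<Sum>S\<in>F. \<Sum>T\<in>F. \<Sum>B\<in>F. (if B \<subseteq> S then a S else 0) * (if B \<subseteq> T then a T else 0) / h B)"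
      by (intro sum.cong refl) (auto simp: g_Un sum_distrib_left a_def intro!: sum.cong)
    also have "\<dots> = (\<Sum>S\<in>F. \<Sum>B\<in>F. \<Sum>T\<in>F. (if B \<subseteq> S then a S else 0) * (if B \<subseteq> T then a T else 0) / h B)"
      by (intro sum.cong refl sum.swap)
    also have "\<dots> = (\<Sum>B\<in>F. \<Sum>S\<in>F. \<Sum>T\<in>F. (if B \<subseteq> S then a S else 0) * (if B \<subseteq> T then a T else 0) / h B)"
      by (rule sum.swap)
    also have "\<dots> = (\<Sum>B\<in>F. (\<Sum>D | D \<in> F \<and> B \<subseteq> D. a D) ^ 2 / h B)"
      using finF by (simp add: power2_eq_square sum_product sum_divide_distrib sum.inter_filter)
    also have "\<dots> = (\<Sum>B\<in>F. h B / G ^ 2)"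
    proof (intro sum.cong refl)
      fix B assume B: "B \<in> F"
      have "(\<Sum>D | D \<in> F \<and> B \<subseteq> D. a D) ^ 2 = h B ^ 2 / G ^ 2"
        unfolding a_def inv[OF B] by (simp add: power_mult_distrib power_divide power_mult[symmetric] mult.commute[of _ 2] power_mult)
      then show "(\<Sum>D | D \<in> F \<and> B \<subseteq> D. a D) ^ 2 / h B = h B / G ^ 2"
        using hpos[OF sub[OF B]] by (simp add: power2_eq_square)
    qed
    also have "\<dots> = 1 / G" using G1 by (simp add: sum_divide_distrib[symmetric] G_def[symmetric] power2_eq_square)
    finally show ?thesis .
  qed
  define c where "c S = real (card {n \<in> N. S \<subseteq> bad n})" for S
  have "real (card {n \<in> N. bad n \<inter> P = {}}) = (\<Sum>n\<in>N. if bad n \<inter> P = {} then 1 else 0)"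
    using N by (simp add: sum.inter_filter[symmetric])
  \<comment> \<open>For a sifted \<open>n\<close> only the empty set survives in the inner sum, so
    the square is 1; for every other \<open>n\<close> a square is nonnegative.\<close>
  also have "\<dots> \<le> (\<Sum>n\<in>N. (\<Sum>S\<in>F. if S \<subseteq> bad n then \<Lambda> S else 0) ^ 2)"
  proof (intro sum_mono)
    fix n assume "n \<in> N"
    show "(if bad n \<inter> P = {} then 1 else 0) \<le> (\<Sum>S\<in>F. if S \<subseteq> bad n then \<Lambda> S else 0) ^ 2"
    proof (cases "bad n \<inter> P = {}")
      case True
      then have "{S \<in> F. S \<subseteq> bad n} = {{}}" using F sub by blast
      then show ?thesis using True finF \<Lambda>1 by (simp add: sum.inter_filter[symmetric])
    qed auto
  qed
  also have "\<dots> = (\<Sum>n\<in>N. \<Sum>S\<in>F. \<Sum>T\<in>F. \<Lambda> S * \<Lambda> T * (if S \<union> T \<subseteq> bad n then 1 else 0))"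
    by (auto simp: power2_eq_square sum_product intro!: sum.cong)
  also have "\<dots> = (\<Sum>S\<in>F. \<Sum>T\<in>F. \<Sum>n\<in>N. \<Lambda> S * \<Lambda> T * (if S \<union> T \<subseteq> bad n then 1 else 0))"
    by (subst sum.swap, intro sum.cong refl, rule sum.swap)
  also have "\<dots> = (\<Sum>S\<in>F. \<Sum>T\<in>F. \<Lambda> S * \<Lambda> T * c (S \<union> T))"
    using N by (simp add: c_def sum_distrib_left[symmetric] sum.inter_filter[symmetric])
  also have "\<dots> \<le> (\<Sum>S\<in>F. \<Sum>T\<in>F. X * (\<Lambda> S * \<Lambda> T * prod g (S \<union> T)) + w S * w T * r (S \<union> T))"
  proof (intro sum_mono)
    fix S T assume S: "S \<in> F" and T: "T \<in> F"
    have "\<Lambda> S * \<Lambda> T * (c (S \<union> T) - X * prod g (S \<union> T)) \<le> \<bar>\<Lambda> S\<bar> * \<bar>\<Lambda> T\<bar> * \<bar>c (S \<union> T) - X * prod g (S \<union> T)\<bar>"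
      by (metis abs_ge_self abs_mult)
    also have "\<dots> \<le> w S * w T * r (S \<union> T)"
      using \<Lambda>_bound[OF S] \<Lambda>_bound[OF T] r[of "S \<union> T"] sub[OF S] sub[OF T]
      by (intro mult_mono) (auto simp: c_def intro: order_trans[OF abs_ge_zero])
    finally show "\<Lambda> S * \<Lambda> T * c (S \<union> T) \<le> X * (\<Lambda> S * \<Lambda> T * prod g (S \<union> T)) + w S * w T * r (S \<union> T)"
      by (simp add: algebra_simps)
  qed
  also have "\<dots> = X * (1 / G) + (\<Sum>S\<in>F. \<Sum>T\<in>F. w S * w T * r (S \<union> T))"
    unfolding Q[symmetric] by (simp add: sum.distrib sum_distrib_left)
  finally show ?thesis by (simp add: G_def h_def w_def)
qed

section \<open>Integers in prescribed residue classes\<close>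

lemma card_cong_less_approx:
  fixes N m a :: nat
  assumes "m > 0"
  shows "\<bar>real (card {n. n < N \<and> [n = a] (mod m)}) - real N / real m\<bar> \<le> 1"
proof -
  define b where "b = a mod m"
  \<comment> \<open>The number of admissible \<open>k\<close> in \<open>b + k * m\<close>;
    \<open>nat\<close> truncates to 0 when \<open>N\<close> does not exceed \<open>b\<close>, where
    there are none.\<close>
  define c where "c = nat \<lceil>(real N - real b) / real m\<rceil>"
  have bm: "b < m" using assms by (simp add: b_def)
  have *: "b + k * m < N \<longleftrightarrow> k < c" for k
  proof -
    have "k < c \<longleftrightarrow> real k < (real N - real b) / real m"
      unfolding c_def by linarith
    also have "\<dots> \<longleftrightarrow> real (b + k * m) < real N"
      using assms by (simp add: field_simps)
    finally show ?thesis by (simp only: of_nat_less_iff)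
  qed
  have "{n. n < N \<and> [n = a] (mod m)} = (\<lambda>k. b + k * m) ` {..<c}"
  proof safe
    fix n assume n: "n < N" "[n = a] (mod m)"
    then have "n = b + (n div m) * m" by (simp add: b_def Cong.cong_def) (metis mod_div_mult_eq add.commute)
    then show "n \<in> (\<lambda>k. b + k * m) ` {..<c}" using * n(1) by (metis imageI lessThan_iff)
  qed (simp_all add: *, simp add: b_def Cong.cong_def)
  then have "card {n. n < N \<and> [n = a] (mod m)} = c"
    using assms by (simp add: card_image inj_on_def)
  moreover have "\<bar>real c - real N / real m\<bar> \<le> 1"
  proof -
    have 1: "0 \<le> real b / real m" "real b / real m < 1" using bm by auto
    have "(real N - real b) / real m = real N / real m - real b / real m" by (simp add: diff_divide_distrib)
    moreover have "0 \<le> real N / real m" by simp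
    ultimately show ?thesis using 1 unfolding c_def by linarith
  qed
  ultimately show ?thesis by simp
qed

text \<open>Adding a prime \<open>l\<close> to \<open>S\<close> splits the class of \<open>a\<close>
  modulo \<open>m\<close> into three classes modulo \<open>l * m\<close> by the Chinese remainder
  theorem. The induction therefore runs over all \<open>m\<close> and \<open>a\<close>, and each
  prime triples the error.\<close>

lemma card_cong_triple_approx:
  fixes S :: "nat set" and N m a :: nat
  assumes "finite S" "\<And>l. l \<in> S \<Longrightarrow> prime l \<and> 3 \<le> l" "\<And>l. l \<in> S \<Longrightarrow> coprime l m" "m > 0"
  shows "\<bar>real (card {n. n < N \<and> [n = a] (mod m) \<and> (\<forall>l\<in>S. l dvd n \<or> l dvd n + 1 \<or> [n = 1] (mod l))})
            - real N / real m * (\<Prod>l\<in>S. 3 / real l)\<bar> \<le> 3 ^ card S"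
  using assms
proof (induction S arbitrary: m a rule: finite_induct)
  case empty
  then show ?case using card_cong_less_approx[of m N a] by simp
next
  case (insert l S)
  have l: "prime l" "l \<ge> 3" "coprime l m" using insert.prems by auto
  define Q where "Q n = (\<forall>l\<in>S. l dvd n \<or> l dvd n + 1 \<or> [n = 1] (mod l))" for n
  have cop: "coprime l' (l * m)" if "l' \<in> S" for l'
    using that insert by (auto intro!: coprime_mult_right_iff[THEN iffD2] primes_coprime)
  have "\<exists>b. \<forall>n. [n = a] (mod m) \<and> [n = c] (mod l) \<longleftrightarrow> [n = b] (mod (l * m))" for c
  proof -
    obtain b where b: "[b = c] (mod l)" "[b = a] (mod m)"
      using binary_chinese_remainder_nat[OF l(3)] by blast
    have "[n = a] (mod m) \<and> [n = c] (mod l) \<longleftrightarrow> [n = b] (mod (l * m))" for n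
    proof
      assume "[n = a] (mod m) \<and> [n = c] (mod l)"
      then have "[n = b] (mod m)" "[n = b] (mod l)" using b by (metis cong_sym cong_trans)+
      then show "[n = b] (mod (l * m))" using l(3) by (simp add: coprime_cong_mult_nat)
    next
      assume "[n = b] (mod (l * m))"
      then show "[n = a] (mod m) \<and> [n = c] (mod l)"
        using b by (metis cong_modulus_mult_nat cong_trans mult.commute)
    qed
    then show ?thesis by blast
  qed
  then obtain f where f: "\<And>c n. [n = a] (mod m) \<and> [n = c] (mod l) \<longleftrightarrow> [n = f c] (mod (l * m))"
    by metis
  define A where "A c = {n. n < N \<and> [n = f c] (mod (l * m)) \<and> Q n}" for c
  \<comment> \<open>The residue \<open>l - 1\<close> stands for -1. The three residues are distinct
    because \<open>l\<close> is at least 3.\<close>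
  define I where "I = {0, 1, l - 1}"
  have cI: "card I = 3" "finite I" using l by (auto simp: I_def)
  have *: "l dvd n \<or> l dvd n + 1 \<or> [n = 1] (mod l) \<longleftrightarrow> (\<exists>c\<in>I. [n = c] (mod l))" for n
  proof -
    have "[n = l - 1] (mod l) \<longleftrightarrow> [n + 1 = l - 1 + 1] (mod l)" by (simp only: cong_add_rcancel_nat)
    then have "[n = l - 1] (mod l) \<longleftrightarrow> l dvd n + 1" using l by (simp add: Cong.cong_def dvd_eq_mod_eq_0)
    then show ?thesis by (auto simp: I_def cong_0_iff)
  qed
  have eq: "{n. n < N \<and> [n = a] (mod m) \<and> (\<forall>l\<in>insert l S. l dvd n \<or> l dvd n + 1 \<or> [n = 1] (mod l))} = (\<Union>c\<in>I. A c)"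
    using * by (simp add: A_def Q_def f[symmetric] del: One_nat_def) blast
  have disj: "A c \<inter> A c' = {}" if "c \<in> I" "c' \<in> I" "c \<noteq> c'" for c c'
  proof -
    have "\<not> [c = c'] (mod l)" using that l by (auto simp: I_def Cong.cong_def)
    then show ?thesis by (auto simp: A_def f[symmetric] dest: cong_sym cong_trans)
  qed
  have card: "real (card (\<Union>c\<in>I. A c)) = (\<Sum>c\<in>I. real (card (A c)))"
    using cI disj by (subst card_UN_disjoint) (auto simp: A_def)
  have "\<bar>(\<Sum>c\<in>I. real (card (A c))) - (\<Sum>c\<in>I. real N / real (l * m) * (\<Prod>l\<in>S. 3 / real l))\<bar>
      \<le> (\<Sum>c\<in>I. 3 ^ card S)"
    unfolding sum_subtractf[symmetric]
  proof (rule order_trans[OF sum_abs], rule sum_mono)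
    fix c
    show "\<bar>real (card (A c)) - real N / real (l * m) * (\<Prod>l\<in>S. 3 / real l)\<bar> \<le> 3 ^ card S"
      unfolding A_def Q_def using insert.prems cop l by (intro insert.IH) (auto simp: prime_gt_0_nat)
  qed
  then show ?case unfolding eq card using insert.hyps cI by (simp add: mult_ac)
qed

section \<open>Reciprocals of integers prime to a modulus\<close>

definition coprimes_upto :: "nat \<Rightarrow> real \<Rightarrow> nat set" where
  "coprimes_upto M y = {n. 0 < n \<and> real n \<le> y \<and> coprime n M}"

lemma finite_coprimes_upto [simp]: "finite (coprimes_upto M y)"
  by (rule finite_subset[of _ "{..nat \<lfloor>y\<rfloor>}"]) (auto simp: coprimes_upto_def le_nat_floor)

text \<open>Each block of \<open>M\<close> consecutive integers ending at \<open>Suc j * M\<close>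
  contains \<open>totient M\<close> integers prime to \<open>M\<close>, with reciprocals at least
  \<open>1 / (Suc j * M)\<close>. Comparing 1 / (j + 1) with a difference of logarithms makes the
  bound telescope.\<close>

lemma sum_inverse_coprime_blocks:
  fixes M i j :: nat
  assumes "M > 0" "i \<le> j"
  shows "totient M / M * (ln (real j + 1) - ln (real i + 1))
      \<le> (\<Sum>n | i * M < n \<and> n \<le> j * M \<and> coprime n M. 1 / real n)"
  using assms(2)
proof (induction j rule: dec_induct)
  case (step j)
  define B where "B = {n. j * M < n \<and> n \<le> Suc j * M \<and> coprime n M}"
  have fin: "finite B" by (rule finite_subset[of _ "{..Suc j * M}"]) (auto simp: B_def)
  have "B = (\<lambda>k. k + j * M) ` totatives M"
  proof safe
    fix n assume n: "n \<in> B"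
    then have "coprime (n - j * M + j * M) M" by (simp add: B_def)
    then have "coprime (n - j * M) M"
      by (metis add.commute coprime_commute coprime_iff_gcd_eq_1 gcd_add_mult)
    then have "n - j * M \<in> totatives M" using n by (auto simp: B_def totatives_def)
    moreover have "n = n - j * M + j * M" using n by (auto simp: B_def)
    ultimately show "n \<in> (\<lambda>k. k + j * M) ` totatives M" by blast
  next
    fix k assume "k \<in> totatives M"
    then show "k + j * M \<in> B"
      by (auto simp: B_def totatives_def) (metis add.commute coprime_commute coprime_iff_gcd_eq_1 gcd_add_mult)
  qed
  then have cardB: "card B = totient M" by (simp add: card_image totient_def)
  have "ln (real j + 2) - ln (real j + 1) \<le> 1 / (real j + 1)"
    using ln_diff_le[of "real j + 2" "real j + 1"] by simp
  then have "totient M / M * (ln (real j + 2) - ln (real j + 1)) \<le> totient M / M * (1 / (real j + 1))"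
    by (intro mult_left_mono) auto
  also have "\<dots> = (\<Sum>n\<in>B. 1 / real (Suc j * M))" by (simp add: cardB algebra_simps)
  also have "\<dots> \<le> (\<Sum>n\<in>B. 1 / real n)"
  proof (intro sum_mono)
    fix n assume "n \<in> B"
    then have "0 < n" "n \<le> Suc j * M" by (auto simp: B_def)
    then have "0 < real n" "real n \<le> real (Suc j * M)" by (simp_all only: of_nat_le_iff of_nat_0_less_iff)
    then show "1 / real (Suc j * M) \<le> 1 / real n" by (intro frac_le) (assumption | simp)+
  qed
  finally have "totient M / M * (ln (real j + 2) - ln (real j + 1)) \<le> (\<Sum>n\<in>B. 1 / real n)" .
  moreover have "(\<Sum>n | i * M < n \<and> n \<le> Suc j * M \<and> coprime n M. 1 / real n) =
     (\<Sum>n | i * M < n \<and> n \<le> j * M \<and> coprime n M. 1 / real n) + (\<Sum>n\<in>B. 1 / real n)"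
  proof (subst sum.union_disjoint[symmetric])
    show "finite {n. i * M < n \<and> n \<le> j * M \<and> coprime n M}"
      by (rule finite_subset[of _ "{..j * M}"]) auto
    have "i * M \<le> j * M" using step by simp
    then have "i * M < n" if "j * M < n" for n using that by (rule le_less_trans)
    then show "(\<Sum>n | i * M < n \<and> n \<le> Suc j * M \<and> coprime n M. 1 / real n) =
       (\<Sum>n\<in>{n. i * M < n \<and> n \<le> j * M \<and> coprime n M} \<union> B. 1 / real n)"
      by (intro sum.cong) (auto simp: B_def)
  qed (use fin in \<open>auto simp: B_def\<close>)
  ultimately show ?case using step.IH by (simp add: algebra_simps)
qed (simp add: sum_nonneg)

text \<open>Rounding \<open>s\<close> up and \<open>t\<close> down to multiples of \<open>M\<close>
  reduces to whole blocks. The loss depends on \<open>M\<close> alone, which makes the bound uniform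
  over long windows.\<close>

lemma sum_inverse_coprime_ge:
  fixes s t :: real
  assumes "M > 0" "1 \<le> s" "s \<le> t"
  shows "totient M / M * (ln t - ln s) - totient M / M * ln (1 + 2 * real M)
      \<le> (\<Sum>n\<in>coprimes_upto M t - coprimes_upto M s. 1 / real n)"
proof -
  define i where "i = nat \<lceil>s / M\<rceil>"
  define j where "j = nat \<lfloor>t / M\<rfloor>"
  have i: "s / M \<le> real i" "real i \<le> s / M + 1" unfolding i_def using assms by auto
  have j: "real j \<le> t / M" "t / M \<le> real j + 1" unfolding j_def using assms by auto
  have iM: "s \<le> real (i * M)" using i assms by (simp add: field_simps)
  have jM: "real (j * M) \<le> t" using j assms by (simp add: field_simps)
  have "ln t - ln s - ln (1 + 2 * real M) \<le> ln (real j + 1) - ln (real i + 1)"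
  proof -
    have "ln t - ln (real M) \<le> ln (real j + 1)"
    proof -
      have "ln (t / M) \<le> ln (real j + 1)" using j assms by simp
      then show ?thesis using assms by (simp add: ln_div)
    qed
    \<comment> \<open>The hypothesis that \<open>s\<close> is at least 1 turns the additive rounding
      error 2 into the factor \<open>1 + 2 * real M\<close>.\<close>
    moreover have "real i + 1 \<le> s * (1 + 2 * real M) / real M"
    proof -
      have "real i + 1 \<le> s / M + 2" using i by simp
      also have "\<dots> \<le> s / M + 2 * s" using assms by simp
      also have "\<dots> = s * (1 + 2 * real M) / real M" using assms by (simp add: field_simps)
      finally show ?thesis .
    qed
    then have "ln (real i + 1) \<le> ln (s * (1 + 2 * real M) / real M)"
      using assms by (subst ln_le_cancel_iff) auto
    then have "ln (real i + 1) \<le> ln s + ln (1 + 2 * real M) - ln (real M)"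
      using assms by (simp add: ln_div ln_mult)
    ultimately show ?thesis by linarith
  qed
  then have "totient M / M * (ln t - ln s) - totient M / M * ln (1 + 2 * real M)
     \<le> totient M / M * (ln (real j + 1) - ln (real i + 1))"
    unfolding right_diff_distrib[symmetric] by (intro mult_left_mono) auto
  also have "\<dots> \<le> (\<Sum>n | i * M < n \<and> n \<le> j * M \<and> coprime n M. 1 / real n)"
  proof (cases "i \<le> j")
    case False
    have "totient M / M * (ln (real j + 1) - ln (real i + 1)) \<le> 0"
      using False by (intro mult_nonneg_nonpos) auto
    also have "0 \<le> (\<Sum>n | i * M < n \<and> n \<le> j * M \<and> coprime n M. 1 / real n)"
      by (intro sum_nonneg) auto
    finally show ?thesis .
  qed (rule sum_inverse_coprime_blocks[OF assms(1)])
  also have "\<dots> \<le> (\<Sum>n\<in>coprimes_upto M t - coprimes_upto M s. 1 / real n)"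
  proof (intro sum_mono2 subsetI)
    fix n assume n: "n \<in> {n. i * M < n \<and> n \<le> j * M \<and> coprime n M}"
    then have "real n \<le> t" "s < real n" using iM jM
      by (auto simp flip: of_nat_mult intro: order_trans[OF _ jM] le_less_trans[OF iM])
    then show "n \<in> coprimes_upto M t - coprimes_upto M s"
      using n by (auto simp: coprimes_upto_def)
  qed auto
  finally show ?thesis .
qed

text \<open>
  \<open>iter_sum m y\<close> is the sum of \<open>1 / (a\<^sub>1 \<cdots> a\<^sub>m)\<close> over the \<open>m\<close>-tuples of integers prime
  to \<open>M\<close> with product at most \<open>y\<close>.
\<close>
fun iter_sum :: "nat \<Rightarrow> nat \<Rightarrow> real \<Rightarrow> real" where
  "iter_sum M 0 y = 1"
| "iter_sum M (Suc m) y = (\<Sum>a\<in>coprimes_upto M y. iter_sum M m (y / a) / a)"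

lemma iter_sum_nonneg: "iter_sum M m y \<ge> 0"
  by (induction m arbitrary: y) (auto intro!: sum_nonneg)

lemma iter_sum_mono: "y \<le> y' \<Longrightarrow> iter_sum M m y \<le> iter_sum M m y'"
proof (induction m arbitrary: y y')
  case (Suc m)
  have "(\<Sum>a\<in>coprimes_upto M y. iter_sum M m (y / a) / a) \<le> (\<Sum>a\<in>coprimes_upto M y. iter_sum M m (y' / a) / a)"
    using Suc by (intro sum_mono divide_right_mono Suc.IH) auto
  also have "\<dots> \<le> (\<Sum>a\<in>coprimes_upto M y'. iter_sum M m (y' / a) / a)"
    using Suc.prems
    by (intro sum_mono2) (simp, auto simp: coprimes_upto_def iter_sum_nonneg)
  finally show ?case by simp
qed (simp add: sum_nonneg)

text \<open>
  Each window \<open>(q\<^sup>i, q\<^bsup>i+1\<^esup>]\<close> has harmonic mass at least \<open>b\<close>; picking the windows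
  of the coordinates amounts to a hockey-stick recursion.
\<close>
lemma iter_sum_power_ge:
  fixes q b :: real
  assumes "M > 0" "q \<ge> 1" "0 \<le> b"
    and b: "b \<le> totient M / M * ln q - totient M / M * ln (1 + 2 * real M)"
  shows "b ^ m * real (n choose m) \<le> iter_sum M m (q ^ n)"
proof (induction m arbitrary: n)
  case (Suc m)
  have q: "q ^ i \<le> q ^ j" if "i \<le> j" for i j using assms that by (simp add: power_increasing)
  define B where "B i = coprimes_upto M (q ^ Suc i) - coprimes_upto M (q ^ i)" for i
  have B: "b \<le> (\<Sum>a\<in>B i. 1 / real a)" for i
  proof -
    have "ln (q ^ Suc i) - ln (q ^ i) = ln q" using assms by (simp add: ln_realpow ln_mult)
    then show ?thesis
      using sum_inverse_coprime_ge[of M "q ^ i" "q ^ Suc i"] assms q[of i "Suc i"] unfolding B_def by simp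
  qed
  \<comment> \<open>If the first coordinate lies in window \<open>i\<close>, it is at most
    \<open>q ^ Suc i\<close> and leaves exponent \<open>n - 1 - i\<close> for the other
    \<open>m\<close> coordinates.\<close>
  have ch: "n choose Suc m = (\<Sum>i<n. (n - 1 - i) choose m)"
  proof (cases n)
    case (Suc k)
    have "(\<Sum>i<n. (n - 1 - i) choose m) = (\<Sum>i\<le>k. i choose m)"
      unfolding Suc using sum.nat_diff_reindex[of "\<lambda>i. i choose m" "Suc k"] by (simp add: lessThan_Suc_atMost)
    then show ?thesis by (simp add: sum_choose_upper Suc)
  qed simp
  have "b ^ Suc m * real (n choose Suc m) = (\<Sum>i<n. b ^ m * real ((n - 1 - i) choose m) * b)"
    by (simp add: ch sum_distrib_left mult_ac)
  also have "\<dots> \<le> (\<Sum>i<n. \<Sum>a\<in>B i. iter_sum M m (q ^ n / a) / a)"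
  proof (intro sum_mono)
    fix i assume i: "i \<in> {..<n}"
    have "b ^ m * real ((n - 1 - i) choose m) * b \<le> b ^ m * real ((n - 1 - i) choose m) * (\<Sum>a\<in>B i. 1 / real a)"
      using B assms by (intro mult_left_mono) auto
    also have "\<dots> = (\<Sum>a\<in>B i. b ^ m * real ((n - 1 - i) choose m) / a)"
      by (simp add: sum_distrib_left)
    also have "\<dots> \<le> (\<Sum>a\<in>B i. iter_sum M m (q ^ n / a) / a)"
    proof (intro sum_mono divide_right_mono)
      fix a assume a: "a \<in> B i"
      have "q ^ n = q ^ (n - 1 - i) * q ^ Suc i" using i by (simp flip: power_add del: power_Suc)
      moreover have "real a \<le> q ^ Suc i" "a > 0" using a by (auto simp: B_def coprimes_upto_def)
      ultimately have "q ^ (n - 1 - i) \<le> q ^ n / a"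
        using assms by (simp add: pos_le_divide_eq mult_left_mono del: power_Suc)
      then show "b ^ m * real ((n - 1 - i) choose m) \<le> iter_sum M m (q ^ n / a)"
        using Suc.IH[of "n - 1 - i"] iter_sum_mono order_trans by blast
    qed auto
    finally show "b ^ m * real ((n - 1 - i) choose m) * b \<le> (\<Sum>a\<in>B i. iter_sum M m (q ^ n / a) / a)" .
  qed
  also have "\<dots> = (\<Sum>a\<in>(\<Union>i<n. B i). iter_sum M m (q ^ n / a) / a)"
  proof (subst sum.UNION_disjoint)
    have "B i \<inter> B j = {}" if "i < j" for i j
      using q[of "Suc i" j] that by (auto simp: B_def coprimes_upto_def)
    then show "\<forall>i\<in>{..<n}. \<forall>j\<in>{..<n}. i \<noteq> j \<longrightarrow> B i \<inter> B j = {}"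
      by (metis inf_commute linorder_neqE_nat)
  qed (auto simp: B_def)
  also have "\<dots> \<le> (\<Sum>a\<in>coprimes_upto M (q ^ n). iter_sum M m (q ^ n / a) / a)"
  proof (intro sum_mono2 subsetI)
    fix a assume "a \<in> (\<Union>i<n. B i)"
    then obtain i where "i < n" "a \<in> coprimes_upto M (q ^ Suc i)" by (auto simp: B_def)
    then show "a \<in> coprimes_upto M (q ^ n)"
      using q[of "Suc i" n] by (auto simp: coprimes_upto_def simp del: power_Suc)
  qed (auto simp: iter_sum_nonneg)
  finally show ?case by simp
qed (simp add: sum_nonneg)

section \<open>The Selberg sum\<close>

definition sieve_primes :: "nat \<Rightarrow> real \<Rightarrow> nat set" where
  "sieve_primes z y = {p. prime p \<and> z < p \<and> real p \<le> y}"

text \<open>A squarefree integer up to \<open>y\<close> is encoded by the set of its prime factors,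
  so divisibility becomes inclusion.\<close>

definition sieve_sets :: "nat \<Rightarrow> real \<Rightarrow> nat set set" where
  "sieve_sets z y = {S. S \<subseteq> sieve_primes z y \<and> real (\<Prod>S) \<le> y}"

text \<open>The denominator of Selberg's bound for the density 3 / p: the factor 3 / (p - 3) is g /
  (1 - g) with g = 3 / p.\<close>

definition selberg_sum :: "nat \<Rightarrow> real \<Rightarrow> real" where
  "selberg_sum z y = (\<Sum>S\<in>sieve_sets z y. \<Prod>p\<in>S. 3 / (real p - 3))"

lemma finite_sieve_primes [simp]: "finite (sieve_primes z y)"
  by (rule finite_subset[of _ "{..nat \<lfloor>y\<rfloor>}"]) (auto simp: sieve_primes_def le_nat_floor)

lemma finite_sieve_sets [simp]: "finite (sieve_sets z y)"
  by (rule finite_subset[of _ "Pow (sieve_primes z y)"]) (auto simp: sieve_sets_def)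

lemma sieve_setsD:
  assumes "S \<in> sieve_sets z y"
  shows "finite S" "\<And>p. p \<in> S \<Longrightarrow> prime p \<and> z < p \<and> real p \<le> y" "real (\<Prod>S) \<le> y"
  using assms finite_subset[OF _ finite_sieve_primes] by (auto simp: sieve_sets_def sieve_primes_def)

lemma prod_le_prod_nat:
  fixes S T :: "nat set"
  assumes "finite T" "S \<subseteq> T" "\<And>p. p \<in> T \<Longrightarrow> p > 0"
  shows "\<Prod>S \<le> \<Prod>T"
  using assms by (intro dvd_imp_le prod_dvd_prod_subset) auto

lemma sieve_setsI:
  assumes "finite S" "\<And>p. p \<in> S \<Longrightarrow> prime p \<and> z < p" "real (\<Prod>S) \<le> y"
  shows "S \<in> sieve_sets z y"
proof -
  have "real p \<le> y" if "p \<in> S" for p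
  proof -
    have "\<Prod>{p} \<le> \<Prod>S" using assms that by (intro prod_le_prod_nat) (auto simp: prime_gt_0_nat)
    then have "real p \<le> real (\<Prod>S)" by (simp del: of_nat_prod)
    then show ?thesis using assms(3) by linarith
  qed
  then show ?thesis using assms by (auto simp: sieve_sets_def sieve_primes_def)
qed

lemma sieve_sets_subset: "T \<in> sieve_sets z y \<Longrightarrow> S \<subseteq> T \<Longrightarrow> S \<in> sieve_sets z y"
proof -
  assume T: "T \<in> sieve_sets z y" and "S \<subseteq> T"
  have "\<Prod>S \<le> \<Prod>T" using sieve_setsD[OF T] \<open>S \<subseteq> T\<close> by (intro prod_le_prod_nat) (auto simp: prime_gt_0_nat)
  then have "real (\<Prod>S) \<le> real (\<Prod>T)" by (simp only: of_nat_le_iff)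
  then show ?thesis using sieve_setsD[OF T] \<open>S \<subseteq> T\<close>
    by (intro sieve_setsI) (auto intro: finite_subset simp del: of_nat_prod)
qed

lemma empty_in_sieve_sets: "y \<ge> 1 \<Longrightarrow> {} \<in> sieve_sets z y"
  by (simp add: sieve_sets_def)

text \<open>\<open>z \<ge> 2\<close> is enough because at p = 3 the factor is 3 / 0, which is 0 by
  convention.\<close>

lemma selberg_weight_nonneg: "S \<in> sieve_sets z y \<Longrightarrow> z \<ge> 2 \<Longrightarrow> (\<Prod>p\<in>S. 3 / (real p - 3)) \<ge> 0"
  by (intro prod_nonneg) (auto dest!: sieve_setsD(2))

section \<open>Comparison of harmonic sums over triples with the Selberg sum\<close>

text \<open>The exponents of \<open>p\<close> in a triple of integers, not all zero, contribute at
  most (1 - 1 / p) to the power -3, minus 1. Bernoulli's inequality bounds the power by 1 / (1 - 3 /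
  p), and subtracting 1 leaves the Selberg weight.\<close>

lemma geometric_cube_bound:
  fixes p :: real
  assumes "p > 3"
  shows "(\<Sum>(i,j,k)\<in>{..n} \<times> {..n} \<times> {..n} - {(0,0,0)}. 1 / (p ^ i * p ^ j * p ^ k)) \<le> 3 / (p - 3)"
proof -
  define s where "s = (\<Sum>i\<le>n. (1 / p) ^ i)"
  have s: "0 \<le> s" "s \<le> 1 / (1 - 1 / p)"
  proof -
    show "0 \<le> s" unfolding s_def using assms by (intro sum_nonneg) auto
    have "s \<le> (\<Sum>i. (1 / p) ^ i)"
      unfolding s_def using assms by (intro sum_le_suminf summable_geometric) auto
    also have "\<dots> = 1 / (1 - 1 / p)" using assms by (intro suminf_geometric) auto
    finally show "s \<le> 1 / (1 - 1 / p)" .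
  qed
  have "(\<Sum>(i,j,k)\<in>{..n} \<times> {..n} \<times> {..n}. 1 / (p ^ i * p ^ j * p ^ k)) = s * (s * s)"
  proof -
    have "s * (s * s) = (\<Sum>i\<le>n. \<Sum>j\<le>n. \<Sum>k\<le>n. (1 / p) ^ i * ((1 / p) ^ j * (1 / p) ^ k))"
      by (simp only: sum_product[of "\<lambda>i. (1 / p) ^ i" "{..n}" "\<lambda>i. (1 / p) ^ i" "{..n}", folded s_def])
        (simp only: s_def sum_distrib_right, simp only: sum_distrib_left)
    then show ?thesis by (simp add: sum.cartesian_product[symmetric] power_divide mult.assoc)
  qed
  then have "(\<Sum>(i,j,k)\<in>{..n} \<times> {..n} \<times> {..n} - {(0,0,0)}. 1 / (p ^ i * p ^ j * p ^ k)) = s ^ 3 - 1"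
    by (subst sum_diff1) (auto simp: power3_eq_cube)
  also have "s ^ 3 \<le> (1 / (1 - 1 / p)) ^ 3" using s by (intro power_mono) auto
  also have "(1 / (1 - 1 / p)) ^ 3 = 1 / (1 - 1 / p) ^ 3" by (simp add: power_divide)
  also have "\<dots> \<le> 1 / (1 - 3 / p)"
  proof (intro divide_left_mono)
    have "1 + real 3 * (- (1 / p)) \<le> (1 + - (1 / p)) ^ 3"
      using assms by (intro Bernoulli_inequality) auto
    then show "1 - 3 / p \<le> (1 - 1 / p) ^ 3" by simp
  qed (use assms in auto)
  also have "1 / (1 - 3 / p) - 1 = 3 / (p - 3)" using assms by (simp add: field_simps)
  finally show ?thesis by simp
qed

text \<open>
  Group the triples \<open>(a, b, c)\<close> by the set \<open>S\<close> of primes dividing \<open>abc\<close>: the triples belonging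
  to \<open>S\<close> contribute at most \<open>\<Prod>p\<in>S. (1 - 1 / p)\<^sup>-\<^sup>3 - 1\<close>, which is below the Selberg weight.
\<close>
lemma iter_sum_le_selberg_sum:
  assumes "z \<ge> 3" "y \<ge> 1"
  shows "iter_sum (fact z) 3 y \<le> selberg_sum z y"
proof -
  define M :: nat where "M = fact z"
  define T where "T = (SIGMA a:coprimes_upto M y. SIGMA b:coprimes_upto M (y / a). coprimes_upto M (y / a / b))"
  define rad where "rad = (\<lambda>(a,b,c). prime_factors (a * b * c :: nat))"
  define f where "f = (\<lambda>(a,b,c). 1 / real (a * b * c :: nat))"
  have finT: "finite T" by (auto simp: T_def)
  have T: "a > 0" "b > 0" "c > 0" "real (a * b * c) \<le> y" "coprime (a * b * c) M"
    if "(a, b, c) \<in> T" for a b c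
  proof -
    show p: "a > 0" "b > 0" "c > 0" using that by (auto simp: T_def coprimes_upto_def)
    show "coprime (a * b * c) M" using that by (auto simp: T_def coprimes_upto_def)
    have "real c \<le> y / a / b" using that by (auto simp: T_def coprimes_upto_def)
    then show "real (a * b * c) \<le> y" using p by (simp add: field_simps)
  qed
  have rad: "rad t \<in> sieve_sets z y" if t: "t \<in> T" for t
  proof -
    obtain a b c where abc: "t = (a, b, c)" using prod_cases3 by blast
    note T = T[OF t[unfolded abc]]
    have "prime p \<and> z < p" if "p \<in> rad t" for p
    proof -
      have p: "prime p" "p dvd a * b * c" using that by (auto simp: rad_def abc)
      then have "\<not> p dvd M" using T(5) by (metis coprime_common_divisor not_prime_unit)
      then show ?thesis using p by (simp add: M_def prime_dvd_fact_iff)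
    qed
    moreover have "\<Prod>(rad t) \<le> a * b * c"
    proof (rule dvd_imp_le)
      have "\<Prod>(prime_factors n) dvd n" if "n > 0" for n :: nat
      proof -
        have "\<Prod>(prime_factors n) dvd (\<Prod>p\<in>prime_factors n. p ^ multiplicity p n)"
          by (intro prod_dvd_prod dvd_power) (auto simp: prime_factors_multiplicity)
        also have "\<dots> = n" using that by (simp add: prime_factorization_nat[symmetric])
        finally show ?thesis .
      qed
      then show "\<Prod>(rad t) dvd a * b * c" using T by (simp add: rad_def abc)
    qed (use T in auto)
    then have "real (\<Prod>(rad t)) \<le> real (a * b * c)" by (simp only: of_nat_le_iff)
    then have "real (\<Prod>(rad t)) \<le> y" using T(4) by linarith
    ultimately show ?thesis by (intro sieve_setsI) (auto simp: rad_def abc simp del: of_nat_prod)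
  qed
  have "iter_sum M 3 y = sum f T"
    by (simp add: numeral_3_eq_3 T_def f_def sum.Sigma[symmetric] sum_divide_distrib mult_ac)
  also have "\<dots> = (\<Sum>S\<in>sieve_sets z y. sum f {t \<in> T. rad t = S})"
    using finT rad by (intro sum.group[symmetric]) auto
  also have "\<dots> \<le> selberg_sum z y"
    unfolding selberg_sum_def
  proof (intro sum_mono)
    fix S assume S: "S \<in> sieve_sets z y"
    define T' where "T' = {t \<in> T. rad t = S}"
    \<comment> \<open>All exponents that occur are at most \<open>n\<close>, so the exponent triples
      range over the finite box \<open>I\<close>, with the origin removed because every prime of
      \<open>S\<close> divides \<open>a * b * c\<close>.\<close>
    define n where "n = nat \<lfloor>y\<rfloor>"
    define I where "I = {..n} \<times> {..n} \<times> {..n} - {(0::nat,0::nat,0::nat)}"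
    define w where "w p = (\<lambda>(i,j,k). 1 / (real p ^ i * real p ^ j * real p ^ k))" for p :: nat
    define e where "e = (\<lambda>(a,b,c). \<lambda>p\<in>S. (multiplicity p a, multiplicity p b, multiplicity p (c::nat)))"
    have T'D: "prime_factors (a * b * c) = S" "a > 0" "b > 0" "c > 0" "a * b * c \<le> n"
      if "(a, b, c) \<in> T'" for a b c
    proof -
      have t: "(a,b,c) \<in> T" "prime_factors (a * b * c) = S" using that by (auto simp: T'_def rad_def)
      show "prime_factors (a * b * c) = S" "a > 0" "b > 0" "c > 0" using t T[OF t(1)] by auto
      show "a * b * c \<le> n" unfolding n_def using T(4)[OF t(1)] by (rule le_nat_floor)
    qed
    have rep: "a = (\<Prod>p\<in>S. p ^ multiplicity p a)" if "a > 0" "a dvd m" "m > 0" "prime_factors m = S" for a m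
    proof -
      have "prime_factors a \<subseteq> S" using that dvd_prime_factors by blast
      then have "(\<Prod>p\<in>S. p ^ multiplicity p a) = (\<Prod>p\<in>prime_factors a. p ^ multiplicity p a)"
        using sieve_setsD[OF S] by (intro prod.mono_neutral_right) (auto simp: prime_factors_multiplicity)
      then show ?thesis using that by (simp add: prime_factorization_nat[symmetric])
    qed
    have rep3: "a = (\<Prod>p\<in>S. p ^ multiplicity p a)" "b = (\<Prod>p\<in>S. p ^ multiplicity p b)"
      "c = (\<Prod>p\<in>S. p ^ multiplicity p c)" if "(a, b, c) \<in> T'" for a b c
      using T'D[OF that] by (intro rep[of _ "a * b * c"]; simp)+
    have f_eq: "f t = (\<Prod>p\<in>S. w p (e t p))" if "t \<in> T'" for t
    proof -
      obtain a b c where abc: "t = (a, b, c)" using prod_cases3 by blast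
      have "f t = 1 / (real (\<Prod>p\<in>S. p ^ multiplicity p a) * real (\<Prod>p\<in>S. p ^ multiplicity p b)
          * real (\<Prod>p\<in>S. p ^ multiplicity p c))"
        using rep3[OF that[unfolded abc]] by (simp add: f_def abc del: of_nat_prod)
      also have "\<dots> = (\<Prod>p\<in>S. w p (e t p))"
        by (simp add: w_def e_def abc prod.distrib prod_dividef)
      finally show ?thesis .
    qed
    have inj: "inj_on e T'"
    proof (rule inj_onI)
      fix s t assume st: "s \<in> T'" "t \<in> T'" "e s = e t"
      obtain a b c where abc: "s = (a, b, c)" using prod_cases3 by blast
      obtain a' b' c' where abc': "t = (a', b', c')" using prod_cases3 by blast
      have "multiplicity p a = multiplicity p a' \<and> multiplicity p b = multiplicity p b' \<and>
          multiplicity p c = multiplicity p c'" if "p \<in> S" for p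
        using fun_cong[OF st(3), of p] that by (simp add: e_def abc abc')
      then have "(\<Prod>p\<in>S. p ^ multiplicity p a) = (\<Prod>p\<in>S. p ^ multiplicity p a')"
        "(\<Prod>p\<in>S. p ^ multiplicity p b) = (\<Prod>p\<in>S. p ^ multiplicity p b')"
        "(\<Prod>p\<in>S. p ^ multiplicity p c) = (\<Prod>p\<in>S. p ^ multiplicity p c')"
        by (auto intro!: prod.cong)
      then show "s = t"
        using rep3[OF st(1)[unfolded abc]] rep3[OF st(2)[unfolded abc']] abc abc' by metis
    qed
    \<comment> \<open>The exponent k of \<open>p\<close> satisfies k < p^k, and p^k divides
      \<open>a\<close>.\<close>
    have mult_le: "multiplicity p a \<le> n" if "a > 0" "a \<le> n" "prime p" for a p :: nat
    proof -
      have "multiplicity p a < p ^ multiplicity p a" using prime_gt_1_nat[OF that(3)] by (intro power_gt_expt) simp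
      also have "\<dots> \<le> a" using that by (intro dvd_imp_le multiplicity_dvd)
      finally show ?thesis using that by simp
    qed
    have img: "e ` T' \<subseteq> PiE S (\<lambda>_. I)"
    proof (rule image_subsetI)
      fix t assume "t \<in> T'"
      obtain a b c where abc: "t = (a, b, c)" using prod_cases3 by blast
      then have t: "(a, b, c) \<in> T'" using \<open>t \<in> T'\<close> by simp
      note D = T'D[OF t]
      have "a dvd a * b * c" "b dvd a * b * c" "c dvd a * b * c" by auto
      then have le: "a \<le> n" "b \<le> n" "c \<le> n"
        using D(2-5) by (meson dvd_imp_le le_trans nat_0_less_mult_iff)+
      show "e t \<in> PiE S (\<lambda>_. I)"
        unfolding abc
      proof (rule PiE_I)
        fix p assume p: "p \<in> S"
        have "prime p" using sieve_setsD(2)[OF S p] by simp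
        have "p dvd a * b * c" using p D(1) by auto
        then have "p dvd a \<or> p dvd b \<or> p dvd c" using \<open>prime p\<close> by (simp add: prime_dvd_mult_iff)
        then have "multiplicity p a \<noteq> 0 \<or> multiplicity p b \<noteq> 0 \<or> multiplicity p c \<noteq> 0"
          using D \<open>prime p\<close> by (metis multiplicity_eq_zero_iff not_prime_unit less_not_refl)
        then show "e (a, b, c) p \<in> I"
          using p D le \<open>prime p\<close> by (auto simp: e_def I_def intro!: mult_le)
      qed (auto simp: e_def)
    qed
    have "sum f T' = (\<Sum>t\<in>T'. \<Prod>p\<in>S. w p (e t p))" by (rule sum.cong[OF refl f_eq])
    also have "\<dots> = (\<Sum>g\<in>e ` T'. \<Prod>p\<in>S. w p (g p))" using inj by (simp add: sum.reindex)
    \<comment> \<open>Dropping the size condition on the triples only adds nonnegative terms and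
      lets the sum factor over the primes of \<open>S\<close>.\<close>
    also have "\<dots> \<le> (\<Sum>g\<in>PiE S (\<lambda>_. I). \<Prod>p\<in>S. w p (g p))"
      using img sieve_setsD(1)[OF S]
      by (intro sum_mono2) (auto simp: I_def w_def split: prod.splits intro!: finite_PiE prod_nonneg)
    also have "\<dots> = (\<Prod>p\<in>S. \<Sum>g\<in>I. w p g)"
      using sieve_setsD(1)[OF S] by (subst prod_sum_PiE) (auto simp: I_def)
    also have "\<dots> \<le> (\<Prod>p\<in>S. 3 / (real p - 3))"
    proof (intro prod_mono conjI)
      fix p assume "p \<in> S"
      then have "real p > 3" using sieve_setsD(2)[OF S] assms by fastforce
      then show "(\<Sum>g\<in>I. w p g) \<le> 3 / (real p - 3)"
        unfolding I_def w_def using geometric_cube_bound[of "real p" n] by (simp add: case_prod_unfold)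
      show "0 \<le> (\<Sum>g\<in>I. w p g)" by (intro sum_nonneg) (auto simp: w_def)
    qed
    finally show "sum f {t \<in> T. rad t = S} \<le> (\<Prod>p\<in>S. 3 / (real p - 3))" by (simp add: T'_def)
  qed
  finally show ?thesis by (simp add: M_def)
qed

text \<open>Since 1 / (1 - 3 / p) = 1 + 3 / (p - 3), the finite product is a sum over sets
  \<open>S\<close> of primes up to \<open>z\<close>. Joining such an \<open>S\<close> with a set
  \<open>T\<close> of primes above \<open>z\<close> is injective, and lowering the level by the
  factor \<open>fact z\<close> keeps the union within level \<open>y\<close>.\<close>

lemma selberg_sum_ge_euler:
  assumes "3 \<le> z0" "z0 \<le> z" "y \<ge> 1"
  shows "(\<Prod>p | prime p \<and> z0 < p \<and> p \<le> z. 1 / (1 - 3 / real p)) * selberg_sum z (y / real (fact z))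
    \<le> selberg_sum z0 y"
proof -
  define P where "P = {p. prime p \<and> z0 < p \<and> p \<le> z}"
  define h where "h S = (\<Prod>p\<in>S. 3 / (real p - 3))" for S :: "nat set"
  have finP: "finite P" by (rule finite_subset[of _ "{..z}"]) (auto simp: P_def)
  have "(\<Prod>p\<in>P. 1 / (1 - 3 / real p)) = (\<Prod>p\<in>P. 3 / (real p - 3) + 1)"
    using assms by (intro prod.cong) (auto simp: P_def field_simps)
  also have "\<dots> = (\<Sum>S\<in>Pow P. h S)" using finP by (subst prod_add) (auto simp: h_def)
  finally have "(\<Prod>p\<in>P. 1 / (1 - 3 / real p)) * selberg_sum z (y / real (fact z))
      = (\<Sum>(S, T)\<in>Pow P \<times> sieve_sets z (y / real (fact z)). h S * h T)"
    by (simp add: selberg_sum_def h_def[symmetric] sum_product sum.cartesian_product)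
  also have "\<dots> = (\<Sum>(S, T)\<in>Pow P \<times> sieve_sets z (y / real (fact z)). h (S \<union> T))"
  proof (intro sum.cong refl, clarify)
    fix S T assume "S \<subseteq> P" "T \<in> sieve_sets z (y / real (fact z))"
    then have "finite S" "finite T" using finP by (auto intro: finite_subset sieve_setsD(1))
    moreover have "S \<subseteq> {..z}" using \<open>S \<subseteq> P\<close> by (auto simp: P_def)
    moreover have "T \<subseteq> {z<..}" using sieve_setsD(2)[OF \<open>T \<in> _\<close>] by auto
    ultimately have "finite S" "finite T" "S \<inter> T = {}" by force+
    then show "h S * h T = h (S \<union> T)" unfolding h_def by (intro prod.union_disjoint[symmetric])
  qed
  also have "\<dots> = (\<Sum>U\<in>(\<lambda>(S, T). S \<union> T) ` (Pow P \<times> sieve_sets z (y / real (fact z))). h U)"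
  proof (subst sum.reindex)
    have "S = (S \<union> T) \<inter> {..z} \<and> T = (S \<union> T) - {..z}"
      if "S \<subseteq> P" "T \<in> sieve_sets z (y / real (fact z))" for S T
      using that by (auto simp: P_def dest: sieve_setsD(2))
    then show "inj_on (\<lambda>(S, T). S \<union> T) (Pow P \<times> sieve_sets z (y / real (fact z)))"
      by (intro inj_onI) (clarsimp, metis)
  qed (simp add: case_prod_unfold)
  also have "\<dots> \<le> (\<Sum>U\<in>sieve_sets z0 y. h U)"
  proof (intro sum_mono2 subsetI)
    fix U assume "U \<in> (\<lambda>(S, T). S \<union> T) ` (Pow P \<times> sieve_sets z (y / real (fact z)))"
    then obtain S T where ST: "U = S \<union> T" "S \<subseteq> P" "T \<in> sieve_sets z (y / real (fact z))" by auto
    note D = sieve_setsD[OF ST(3)]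
    have finS: "finite S" using ST(2) finP finite_subset by blast
    \<comment> \<open>Distinct primes up to \<open>z\<close> are distinct factors of the factorial,
      which bounds all \<open>S\<close> at once.\<close>
    have "\<Prod>S dvd \<Prod>{1..z}" using ST(2) by (intro prod_dvd_prod_subset) (auto simp: P_def prime_gt_0_nat Suc_le_eq)
    then have "\<Prod>S \<le> fact z" by (intro dvd_imp_le) (auto simp: fact_prod)
    then have "real (\<Prod>S) \<le> real (fact z)" by (simp only: of_nat_le_iff)
    then have "real (\<Prod>S) * real (\<Prod>T) \<le> real (fact z) * (y / real (fact z))"
      using D(3) by (intro mult_mono) (auto intro: prod_nonneg)
    moreover have "\<Prod>U = \<Prod>S * \<Prod>T" unfolding ST(1)
    proof (intro prod.union_disjoint finS D(1))
      have "S \<subseteq> {..z}" using ST(2) by (auto simp: P_def)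
      moreover have "T \<subseteq> {z<..}" using D(2) by auto
      ultimately show "S \<inter> T = {}" by force
    qed
    ultimately have "real (\<Prod>U) \<le> y" by simp
    moreover have "prime p \<and> z0 < p" if "p \<in> U" for p
      using that ST(1,2) D(2)[of p] assms(2) by (auto simp: P_def)
    moreover have "finite U" using finS D(1) ST(1) by simp
    ultimately show "U \<in> sieve_sets z0 y" by (intro sieve_setsI)
  next
    fix U assume "U \<in> sieve_sets z0 y - (\<lambda>(S, T). S \<union> T) ` (Pow P \<times> sieve_sets z (y / real (fact z)))"
    then show "0 \<le> h U" unfolding h_def using selberg_weight_nonneg[of U z0 y] assms(1) by simp
  qed simp
  finally show ?thesis by (simp add: selberg_sum_def h_def P_def)
qed

section \<open>Application of the sieve\<close>

lemma prime_factors_prod_primes: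
  assumes "finite S" "\<And>p. p \<in> S \<Longrightarrow> prime (p::nat)"
  shows "prime_factors (\<Prod>S) = S"
proof -
  have "\<Prod>S \<noteq> 0" using assms by (metis not_prime_0 prod_zero_iff)
  moreover have "prime p \<and> p dvd \<Prod>S \<longleftrightarrow> p \<in> S" for p
    using assms by (metis dvd_prodI prime_dvd_prod_iff primes_dvd_imp_eq)
  ultimately show ?thesis by (auto simp: prime_factors_dvd)
qed

lemma card_sieve_sets_le:
  assumes "y \<ge> 0"
  shows "real (card (sieve_sets z y)) \<le> y"
proof -
  have "inj_on Prod (sieve_sets z y)"
    by (rule inj_on_inverseI[of _ prime_factors]) (auto intro!: prime_factors_prod_primes dest: sieve_setsD)
  moreover have "\<Prod>S \<in> {1..nat \<lfloor>y\<rfloor>}" if "S \<in> sieve_sets z y" for S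
  proof -
    have "\<Prod>S \<noteq> 0" using sieve_setsD[OF that] by (metis not_prime_0 prod_zero_iff)
    then show ?thesis using le_nat_floor[OF sieve_setsD(3)[OF that]] by simp
  qed
  ultimately have "card (sieve_sets z y) \<le> card {1..nat \<lfloor>y\<rfloor>}"
    by (intro card_inj_on_le[of Prod]) auto
  then show ?thesis using assms by simp linarith
qed

text \<open>A prime p above \<open>c powr (1 / \<epsilon>)\<close> satisfies
  \<open>c \<le> p powr \<epsilon>\<close>, and at most \<open>L\<close> primes lie below, costing
  the constant \<open>c ^ L\<close>. This keeps the sieve remainder within an arbitrarily small
  power of the level.\<close>

lemma power_card_primes_le:
  fixes c \<epsilon> :: real
  assumes "c \<ge> 1" "\<epsilon> > 0"
  obtains C where "C \<ge> 0" "\<And>S. finite S \<Longrightarrow> (\<And>p. p \<in> S \<Longrightarrow> prime (p::nat)) \<Longrightarrow> c ^ card S \<le> C * real (\<Prod>S) powr \<epsilon>"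
proof
  define L where "L = nat \<lceil>c powr (1 / \<epsilon>)\<rceil>"
  show "c ^ L \<ge> 0" using assms by simp
  fix S :: "nat set" assume S: "finite S" "\<And>p. p \<in> S \<Longrightarrow> prime p"
  have pos: "real p \<ge> 1" if "p \<in> S" for p using prime_ge_1_nat[OF S(2)[OF that]] by simp
  have "c ^ card S = (\<Prod>p\<in>S. c)" by simp
  also have "\<dots> \<le> (\<Prod>p\<in>S. (if p \<in> {1..L} then c else 1) * real p powr \<epsilon>)"
  proof (intro prod_mono conjI)
    fix p assume p: "p \<in> S"
    show "c \<le> (if p \<in> {1..L} then c else 1) * real p powr \<epsilon>"
    proof (cases "p \<in> {1..L}")
      case True
      have "1 \<le> real p powr \<epsilon>" using pos[OF p] assms by (intro ge_one_powr_ge_zero) auto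
      then have "c * 1 \<le> c * real p powr \<epsilon>" using assms by (intro mult_left_mono) auto
      then show ?thesis using True by simp
    next
      case False
      then have "c powr (1 / \<epsilon>) \<le> real p" using pos[OF p] unfolding L_def by auto linarith
      then have "(c powr (1 / \<epsilon>)) powr \<epsilon> \<le> real p powr \<epsilon>" using assms by (intro powr_mono2) auto
      then show ?thesis using False assms by (auto simp: powr_powr)
    qed
  qed (use assms in auto)
  also have "\<dots> = (\<Prod>p\<in>S. if p \<in> {1..L} then c else 1) * (\<Prod>p\<in>S. real p powr \<epsilon>)" by (rule prod.distrib)
  also have "(\<Prod>p\<in>S. real p powr \<epsilon>) = real (\<Prod>S) powr \<epsilon>" by (simp add: prod_powr_distrib)
  also have "(\<Prod>p\<in>S. if p \<in> {1..L} then c else 1) = c ^ card (S \<inter> {1..L})"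
    using S(1) by (simp add: prod.If_cases Int_def conj_commute)
  also have "\<dots> \<le> c ^ L"
    using assms card_mono[of "{1..L}" "S \<inter> {1..L}"] by (intro power_increasing) auto
  finally show "c ^ card S \<le> c ^ L * real (\<Prod>S) powr \<epsilon>" by (simp add: mult_right_mono)
qed

lemma card_sifted_triple_le:
  fixes N :: nat and y :: real
  assumes "y \<ge> 1"
  shows "real (card {n. n < N \<and> [n = 5] (mod 6) \<and>
      (\<forall>l\<in>sieve_primes 4 y. \<not> (l dvd n \<or> l dvd n + 1 \<or> [n = 1] (mod l)))})
    \<le> real N / 6 / selberg_sum 4 y + (\<Sum>S\<in>sieve_sets 4 y. 9 ^ card S) ^ 2"
proof -
  define P where "P = sieve_primes 4 y"
  define F where "F = sieve_sets 4 y"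
  define g where "g p = 3 / real p" for p :: nat
  define A where "A = {n. n < N \<and> [n = 5] (mod 6)}"
  define bad where "bad n = {l. l dvd n \<or> l dvd n + 1 \<or> [n = 1] (mod l)}" for n :: nat
  have P5: "real p \<ge> 5" "prime p" if "p \<in> P" for p using that by (auto simp: P_def sieve_primes_def)
  have F: "S \<subseteq> P" "finite S" if "S \<in> F" for S
    using that sieve_setsD(1)[of S 4 y] by (simp_all add: F_def P_def sieve_sets_def)
  have "real (card {n \<in> A. bad n \<inter> P = {}})
    \<le> real N / 6 / (\<Sum>S\<in>F. \<Prod>p\<in>S. g p / (1 - g p))
       + (\<Sum>S\<in>F. \<Sum>T\<in>F. (\<Prod>p\<in>S. 1 / (1 - g p)) * (\<Prod>p\<in>T. 1 / (1 - g p)) * 3 ^ card (S \<union> T))"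
  proof (rule selberg_upper_bound)
    show "finite P" by (simp add: P_def)
    show "0 < g p" "g p < 1" if "p \<in> P" for p using P5[OF that] by (auto simp: g_def)
    show "F \<subseteq> Pow P" using F by blast
    show "{} \<in> F" using assms by (simp add: F_def empty_in_sieve_sets)
    show "S \<in> F" if "T \<in> F" "S \<subseteq> T" for S T using that by (auto simp: F_def intro: sieve_sets_subset)
    show "finite A" by (simp add: A_def)
    fix S assume S: "S \<subseteq> P"
    have fin: "finite S" using finite_subset[OF S] by (simp add: P_def)
    have cop: "coprime l 6" if "l \<in> S" for l
    proof -
      have "prime l" "l \<noteq> 2" "l \<noteq> 3" using P5[of l] that S by auto
      then have "coprime l 2" "coprime l 3" using primes_coprime[of l 2] primes_coprime[of l 3] by simp_all
      then have "coprime l (2 * 3)" by (simp only: coprime_mult_right_iff)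
      then show ?thesis by simp
    qed
    have "l \<ge> 3" if "l \<in> S" for l using P5[of l] that S by auto
    then have "\<bar>real (card {n. n < N \<and> [n = 5] (mod 6) \<and> (\<forall>l\<in>S. l dvd n \<or> l dvd n + 1 \<or> [n = 1] (mod l))})
            - real N / real 6 * (\<Prod>l\<in>S. 3 / real l)\<bar> \<le> 3 ^ card S"
      using S P5 cop by (intro card_cong_triple_approx fin) auto
    moreover have "{n \<in> A. S \<subseteq> bad n} = {n. n < N \<and> [n = 5] (mod 6) \<and> (\<forall>l\<in>S. l dvd n \<or> l dvd n + 1 \<or> [n = 1] (mod l))}"
      by (auto simp: A_def bad_def)
    ultimately show "\<bar>real (card {n \<in> A. S \<subseteq> bad n}) - real N / 6 * prod g S\<bar> \<le> 3 ^ card S"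
      by (simp add: g_def)
  qed
  also have "(\<Sum>S\<in>F. \<Prod>p\<in>S. g p / (1 - g p)) = selberg_sum 4 y"
    unfolding selberg_sum_def F_def[symmetric]
  proof (intro sum.cong prod.cong refl)
    fix S p assume "S \<in> F" "p \<in> S"
    then have "real p \<ge> 5" using F P5 by blast
    then show "g p / (1 - g p) = 3 / (real p - 3)" by (simp add: g_def field_simps)
  qed
  also have "(\<Sum>S\<in>F. \<Sum>T\<in>F. (\<Prod>p\<in>S. 1 / (1 - g p)) * (\<Prod>p\<in>T. 1 / (1 - g p)) * 3 ^ card (S \<union> T))
     \<le> (\<Sum>S\<in>F. \<Sum>T\<in>F. 9 ^ card S * 9 ^ card T)"
  \<comment> \<open>All primes are at least 5, so 1 / (1 - 3 / p) is at most 5 / 2 < 3. Together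
    with the remainder, each of \<open>S\<close> and \<open>T\<close> receives 3 * 3 = 9 per
    prime.\<close>
  proof (intro sum_mono)
    fix S T assume S: "S \<in> F" and T: "T \<in> F"
    have w: "0 \<le> (\<Prod>p\<in>S. 1 / (1 - g p)) \<and> (\<Prod>p\<in>S. 1 / (1 - g p)) \<le> 3 ^ card S" if S: "S \<in> F" for S
    proof
      have *: "0 \<le> 1 / (1 - g p)" "1 / (1 - g p) \<le> 3" if "p \<in> S" for p
        using P5[of p] F(1)[OF S] that by (auto simp: g_def field_simps)
      then show "0 \<le> (\<Prod>p\<in>S. 1 / (1 - g p))" by (intro prod_nonneg) auto
      have "(\<Prod>p\<in>S. 1 / (1 - g p)) \<le> (\<Prod>p\<in>S. 3)" using * by (intro prod_mono) auto
      then show "(\<Prod>p\<in>S. 1 / (1 - g p)) \<le> 3 ^ card S" by simp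
    qed
    have "(3::real) ^ card (S \<union> T) \<le> 3 ^ (card S + card T)" by (intro power_increasing card_Un_le) auto
    then have "(\<Prod>p\<in>S. 1 / (1 - g p)) * (\<Prod>p\<in>T. 1 / (1 - g p)) * 3 ^ card (S \<union> T)
      \<le> 3 ^ card S * 3 ^ card T * 3 ^ (card S + card T)"
      using w[OF S] w[OF T] by (intro mult_mono) auto
    also have "\<dots> = (3 * 3) ^ card S * (3 * 3) ^ card T" by (simp only: power_add power_mult_distrib mult_ac)
    finally show "(\<Prod>p\<in>S. 1 / (1 - g p)) * (\<Prod>p\<in>T. 1 / (1 - g p)) * 3 ^ card (S \<union> T) \<le> 9 ^ card S * 9 ^ card T"
      by simp
  qed
  also have "\<dots> = (\<Sum>S\<in>F. 9 ^ card S) ^ 2" by (simp add: power2_eq_square sum_product)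
  also have "{n \<in> A. bad n \<inter> P = {}} = {n. n < N \<and> [n = 5] (mod 6) \<and>
      (\<forall>l\<in>sieve_primes 4 y. \<not> (l dvd n \<or> l dvd n + 1 \<or> [n = 1] (mod l)))}"
    unfolding A_def bad_def P_def by blast
  finally show ?thesis by (simp add: F_def)
qed

section \<open>Counting \<open>set_A\<close> through the sieve\<close>

lemma set_A_cong_5: "p \<in> set_A \<Longrightarrow> [p = 5] (mod 6)"
proof -
  assume "p \<in> set_A"
  then obtain a b q where "[p = 2] (mod 3)" "a \<ge> 1" "p + 1 = 2 ^ a * 3 ^ b * q"
    by (auto simp: set_A_def)
  moreover from this have "even (p + 1)" by simp
  ultimately have "even (p + 1)" "p mod 3 = 2" by (simp_all add: Cong.cong_def)
  then have "[p = 5] (mod 2)" "[p = 5] (mod 3)" by (simp_all add: Cong.cong_def odd_iff_mod_2_eq_one)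
  then have "[p = 5] (mod (2 * 3))" by (intro coprime_cong_mult_nat) auto
  then show ?thesis by simp
qed

text \<open>
  An element of \<open>set_A\<close> that the sieve removes is at most \<open>y\<close> or has \<open>q \<le> y\<close> or \<open>r \<le> y\<close>.
\<close>
lemma card_set_A_exceptional_le:
  fixes N :: nat and y :: real
  assumes "y \<ge> 1" "N \<ge> 1"
  shows "real (card {p \<in> set_A. p < N \<and> (\<exists>l\<in>sieve_primes 4 y. l dvd p \<or> l dvd p + 1 \<or> [p = 1] (mod l))})
    \<le> 3 * (log 2 (real N) + 1) ^ 2 * (y + 1)"
proof -
  define Y where "Y = nat \<lfloor>y\<rfloor>"
  define L where "L = nat \<lfloor>log 2 (real N)\<rfloor>"
  define E where "E = {p \<in> set_A. p < N \<and> (\<exists>l\<in>sieve_primes 4 y. l dvd p \<or> l dvd p + 1 \<or> [p = 1] (mod l))}"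
  \<comment> \<open>\<open>E1\<close> collects the case of small \<open>q\<close> and
    \<open>E2\<close> that of small \<open>r\<close>. The bound \<open>L\<close> covers all
    exponents, also those of 3, since 2^b \<le> 3^b.\<close>
  define E1 where "E1 = (\<lambda>(a,b,q). 2 ^ a * 3 ^ b * q - 1 :: nat) ` ({..L} \<times> {..L} \<times> {..Y})"
  define E2 where "E2 = (\<lambda>(a,r). 2 ^ a * r + 1 :: nat) ` ({..L} \<times> {..Y})"
  have L: "a \<le> L" if "2 ^ a \<le> N" for a
  proof -
    have "(2::real) ^ a \<le> real N" using that by (metis of_nat_le_iff of_nat_numeral of_nat_power)
    then have "real a \<le> log 2 (real N)" using assms by (simp add: le_log_iff powr_realpow)
    then show ?thesis unfolding L_def by (rule le_nat_floor)
  qed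
  have "E \<subseteq> {..Y} \<union> E1 \<union> E2"
  proof
    fix p assume p: "p \<in> E"
    then obtain l where l: "prime l" "l > 4" "real l \<le> y" "l dvd p \<or> l dvd p + 1 \<or> [p = 1] (mod l)"
      by (auto simp: E_def sieve_primes_def)
    have lY: "l \<le> Y" unfolding Y_def using l(3) by (rule le_nat_floor)
    obtain a b c q r where pr: "prime p" "prime q" "prime r" "p + 1 = 2 ^ a * 3 ^ b * q" "p - 1 = 2 ^ c * r"
      using p by (auto simp: E_def set_A_def)
    have pN: "p + 1 \<le> N" using p by (auto simp: E_def)
    \<comment> \<open>As \<open>l\<close> exceeds 4, it divides no power of 2 or 3. It must
      therefore equal one of the primes \<open>p\<close>, \<open>q\<close>, \<open>r\<close>, which
      is then at most \<open>Y\<close>.\<close>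
    have l2: "\<not> l dvd 2 ^ k" for k using l(1,2) prime_dvd_power[of l 2 k] dvd_imp_le[of l 2] by auto
    have l3: "\<not> l dvd 3 ^ k" for k using l(1,2) prime_dvd_power[of l 3 k] dvd_imp_le[of l 3] by auto
    consider "l dvd p" | "l dvd p + 1" | "l dvd p - 1"
      using l(4) pr(1) by (metis cong_altdef_nat prime_ge_1_nat)
    then show "p \<in> {..Y} \<union> E1 \<union> E2"
    proof cases
      case 1
      then have "l = p" using l(1) pr(1) by (simp add: primes_dvd_imp_eq)
      then show ?thesis using lY by simp
    next
      case 2
      then have "l dvd q" using l2 l3 l(1) unfolding pr(4) by (metis prime_dvd_mult_iff)
      then have "l = q" using l(1) pr(2) by (simp add: primes_dvd_imp_eq)
      have "2 ^ a dvd p + 1" "3 ^ b dvd p + 1" unfolding pr(4) by auto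
      then have "2 ^ a \<le> N" "3 ^ b \<le> N" using pN by (auto dest!: dvd_imp_le)
      moreover have "(2::nat) ^ b \<le> 3 ^ b" by (rule power_mono) auto
      ultimately have "a \<le> L" "b \<le> L" by (auto intro!: L)
      moreover have "p = 2 ^ a * 3 ^ b * q - 1" using pr(4) by simp
      ultimately have "p \<in> E1" unfolding E1_def using \<open>l = q\<close> lY by (intro image_eqI[of _ _ "(a,b,q)"]) auto
      then show ?thesis by blast
    next
      case 3
      then have "l dvd r" using l2 l(1) unfolding pr(5) by (metis prime_dvd_mult_iff)
      then have "l = r" using l(1) pr(3) by (simp add: primes_dvd_imp_eq)
      have p1: "p - 1 > 0" using prime_gt_1_nat[OF pr(1)] by simp
      have "2 ^ c dvd p - 1" unfolding pr(5) by auto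
      then have "2 ^ c \<le> N" using pN p1 by (auto dest!: dvd_imp_le)
      then have "c \<le> L" by (rule L)
      moreover have "p = 2 ^ c * r + 1" using pr(5) p1 by linarith
      ultimately have "p \<in> E2" unfolding E2_def using \<open>l = r\<close> lY by (intro image_eqI[of _ _ "(c,r)"]) auto
      then show ?thesis by blast
    qed
  qed
  then have "card E \<le> card ({..Y} \<union> E1 \<union> E2)" by (intro card_mono) (auto simp: E1_def E2_def)
  also have "\<dots> \<le> card {..Y} + card E1 + card E2"
    by (meson add_mono card_Un_le le_trans order_refl)
  also have "\<dots> \<le> Suc Y + Suc L * (Suc L * Suc Y) + Suc L * Suc Y"
    unfolding E1_def E2_def by (intro add_mono order_trans[OF card_image_le]) auto
  also have "\<dots> \<le> 3 * Suc L ^ 2 * Suc Y"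
  proof -
    have "Suc Y \<le> Suc L * Suc Y" "Suc L * Suc Y \<le> Suc L * (Suc L * Suc Y)" by auto
    then show ?thesis by (simp only: power2_eq_square mult.assoc)
  qed
  finally have "real (card E) \<le> real (3 * Suc L ^ 2 * Suc Y)" by (simp only: of_nat_le_iff)
  also have "\<dots> = 3 * (real L + 1) ^ 2 * (real Y + 1)" by (simp add: distrib_left add.commute)
  also have "\<dots> \<le> 3 * (log 2 (real N) + 1) ^ 2 * (y + 1)"
  proof -
    have "log 2 (real N) \<ge> 0" using assms by simp
    then have "real L \<le> log 2 (real N)" "real Y \<le> y" using assms by (auto simp: L_def Y_def)
    then show ?thesis by (intro mult_mono power_mono) auto
  qed
  finally show ?thesis by (simp add: E_def)
qed

lemma card_set_A_le:
  fixes x y :: real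
  assumes "x \<ge> 1" "y \<ge> 1"
  shows "real (card {p \<in> set_A. real p \<le> x})
    \<le> (x + 1) / 6 / selberg_sum 4 y + (\<Sum>S\<in>sieve_sets 4 y. 9 ^ card S) ^ 2
       + 3 * (log 2 (x + 1) + 1) ^ 2 * (y + 1)"
proof -
  define N where "N = nat \<lfloor>x\<rfloor> + 1"
  define bad where "bad p = (\<exists>l\<in>sieve_primes 4 y. l dvd p \<or> l dvd p + 1 \<or> [p = 1] (mod l))" for p
  define A where "A = {n. n < N \<and> [n = 5] (mod 6) \<and> \<not> bad n}"
  define E where "E = {p \<in> set_A. p < N \<and> bad p}"
  have N: "1 \<le> N" "real N \<le> x + 1" using assms by (auto simp: N_def)
  have "{p \<in> set_A. real p \<le> x} \<subseteq> A \<union> E"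
    by (auto simp: A_def E_def N_def set_A_cong_5 less_Suc_eq_le le_nat_floor)
  moreover have "finite (A \<union> E)" by (rule finite_subset[of _ "{..<N}"]) (auto simp: A_def E_def)
  ultimately have "card {p \<in> set_A. real p \<le> x} \<le> card A + card E"
    by (meson card_Un_le card_mono le_trans)
  then have "real (card {p \<in> set_A. real p \<le> x}) \<le> real (card A) + real (card E)" by linarith
  moreover have "real (card A) \<le> real N / 6 / selberg_sum 4 y + (\<Sum>S\<in>sieve_sets 4 y. 9 ^ card S) ^ 2"
    using card_sifted_triple_le[OF assms(2), of N] by (simp add: A_def bad_def)
  moreover have "real (card E) \<le> 3 * (log 2 (real N) + 1) ^ 2 * (y + 1)"
    using card_set_A_exceptional_le[OF assms(2) N(1)] by (simp add: E_def bad_def)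
  moreover have "\<dots> \<le> 3 * (log 2 (x + 1) + 1) ^ 2 * (y + 1)"
  proof -
    have "0 \<le> log 2 (real N)" "log 2 (real N) \<le> log 2 (x + 1)" using N assms by auto
    then show ?thesis using assms by (intro mult_mono power_mono) auto
  qed
  moreover have "selberg_sum 4 y \<ge> 0"
    unfolding selberg_sum_def by (intro sum_nonneg selberg_weight_nonneg) auto
  then have "real N / 6 / selberg_sum 4 y \<le> (x + 1) / 6 / selberg_sum 4 y"
    using N by (intro divide_right_mono) auto
  ultimately show ?thesis by linarith
qed

section \<open>Asymptotics\<close>

text \<open>The parameter \<open>n\<close> plays two roles: primes up to \<open>n\<close> are split
  off as an Euler product, and the range up to \<open>y / M\<close> is cut into \<open>n\<close>
  geometric windows of ratio \<open>q\<close>. The number \<open>b\<close> is the guaranteed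
  harmonic mass of one window.\<close>

lemma selberg_sum_ge:
  fixes n :: nat and y :: real
  defines "M \<equiv> fact n :: nat"
  defines "b \<equiv> totient M / M * (ln (y / M) / n) - totient M / M * ln (1 + 2 * real M)"
  assumes "n \<ge> 4" "y \<ge> M" "b \<ge> 0"
  shows "(\<Prod>p | prime p \<and> 4 < p \<and> p \<le> n. 1 / (1 - 3 / real p)) * (b ^ 3 * real (n choose 3)) \<le> selberg_sum 4 y"
proof -
  have M: "M > 0" "real M = fact n" by (auto simp: M_def)
  define q where "q = (y / M) powr (1 / n)"
  have y1: "1 \<le> y / M" using assms(4) M by simp
  have q: "q \<ge> 1" "q ^ n = y / M" "ln q = ln (y / M) / n"
  proof -
    show "q \<ge> 1" unfolding q_def using y1 by (intro ge_one_powr_ge_zero) auto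
    have "(t powr (1 / n)) ^ n = t" if "t \<ge> 1" for t :: real
      using that assms(3) by (simp add: powr_powr flip: powr_realpow)
    then show "q ^ n = y / M" unfolding q_def using y1 .
    show "ln q = ln (y / M) / n" using y1 by (simp add: q_def ln_powr)
  qed
  have "b ^ 3 * real (n choose 3) \<le> iter_sum M 3 (q ^ n)"
    using M(1) q(1) assms(5) by (rule iter_sum_power_ge) (simp only: b_def q(3))
  also have "\<dots> \<le> selberg_sum n (y / M)"
    unfolding q(2) M_def using assms(3) y1 by (intro iter_sum_le_selberg_sum) (auto simp: M_def)
  finally have "(\<Prod>p | prime p \<and> 4 < p \<and> p \<le> n. 1 / (1 - 3 / real p)) * (b ^ 3 * real (n choose 3))
      \<le> (\<Prod>p | prime p \<and> 4 < p \<and> p \<le> n. 1 / (1 - 3 / real p)) * selberg_sum n (y / M)"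
    by (intro mult_left_mono prod_nonneg) auto
  also have "\<dots> \<le> selberg_sum 4 y"
  proof -
    have "1 \<le> M" by (simp add: M_def)
    then have "y \<ge> 1" using assms(4) by linarith
    then show ?thesis using selberg_sum_ge_euler[of 4 n y] assms(3) by (simp add: M_def)
  qed
  finally show ?thesis .
qed

text \<open>The sieve is applied with level \<open>y = x powr \<theta>\<close> and \<open>n\<close>
  fixed. The window mass is then \<open>A * ln x - B\<close> with constants \<open>A\<close> and
  \<open>B\<close>, so the main term has order x / (log x)^3, and both error terms are smaller by a
  power of x.\<close>

lemma Limsup_set_A_le:
  fixes n :: nat and \<theta> :: real
  assumes "n \<ge> 4" "0 < \<theta>" "\<theta> < 1 / 2"
  defines "\<delta> \<equiv> real (totient (fact n)) / fact n"
  shows "Limsup at_top (\<lambda>x :: real. ereal (real (card {p \<in> set_A. real p \<le> x}) / (x / (ln x) ^ 3)))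
    \<le> ereal (1 / (6 * (\<Prod>p | prime p \<and> 4 < p \<and> p \<le> n. 1 / (1 - 3 / real p)) * real (n choose 3))
        * (1 / (\<delta> * \<theta> / n)) ^ 3)"
proof -
  define M where "M = (fact n :: nat)"
  define H where "H = (\<Prod>p | prime p \<and> 4 < p \<and> p \<le> n. 1 / (1 - 3 / real p))"
  define K where "K = real (n choose 3)"
  define A where "A = \<delta> * \<theta> / n"
  define B where "B = \<delta> * ln M / n + \<delta> * ln (1 + 2 * real M)"
  \<comment> \<open>Twice \<open>\<theta>\<close> is 1 - \<epsilon>, so the squared remainder, of
    order \<open>y powr (2 + 2 * \<epsilon>)\<close>, is x to the power (1 - \<epsilon>)(1 +
    \<epsilon>) = 1 - \<epsilon>^2, below 1.\<close>
  define \<epsilon> where "\<epsilon> = 1 - 2 * \<theta>"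
  have M: "M > 0" "real M = fact n" by (auto simp: M_def)
  have \<delta>: "\<delta> > 0" by (simp add: \<delta>_def)
  have H: "H > 0" unfolding H_def by (intro prod_pos) auto
  have K: "K > 0" using assms(1) by (simp add: K_def)
  have A: "A > 0" using \<delta> assms by (simp add: A_def)
  have \<epsilon>: "\<epsilon> > 0" using assms by (simp add: \<epsilon>_def)
  obtain C where C: "C \<ge> 0" "\<And>S. finite S \<Longrightarrow> (\<And>p. p \<in> S \<Longrightarrow> prime (p::nat)) \<Longrightarrow> 9 ^ card S \<le> C * real (\<Prod>S) powr \<epsilon>"
    using power_card_primes_le[of 9 \<epsilon>] \<epsilon> by auto
  \<comment> \<open>The three summands are the Selberg main term, the sieve remainder and the
    exceptional elements, each multiplied by \<open>ln x ^ 3 / x\<close>.\<close>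
  define rhs where "rhs x = 1 / (6 * H * K) * ((x + 1) / x * (ln x / (A * ln x - B)) ^ 3)
      + C ^ 2 * (x powr (1 - \<epsilon> ^ 2) * ln x ^ 3 / x)
      + 3 * ((log 2 (x + 1) + 1) ^ 2 * (x powr \<theta> + 1) * ln x ^ 3 / x)" for x
  have ev: "eventually (\<lambda>x. x > 1) (at_top :: real filter)"
    "eventually (\<lambda>x. x powr \<theta> \<ge> real M) at_top" "eventually (\<lambda>x. A * ln x - B > 0) at_top"
  proof -
    show "eventually (\<lambda>x. x > 1) (at_top :: real filter)" by (rule eventually_gt_at_top)
    have "filterlim (\<lambda>x. x powr \<theta>) at_top at_top" using assms(2) by real_asymp
    then show "eventually (\<lambda>x. x powr \<theta> \<ge> real M) at_top" by (simp add: filterlim_at_top)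
    have "filterlim (\<lambda>x. A * ln x - B) at_top at_top" using A by real_asymp
    then show "eventually (\<lambda>x. A * ln x - B > 0) at_top" unfolding filterlim_at_top_dense by blast
  qed
  have le: "eventually (\<lambda>x. real (card {p \<in> set_A. real p \<le> x}) / (x / (ln x) ^ 3) \<le> rhs x) at_top"
    using ev
  proof eventually_elim
    case (elim x)
    define y where "y = x powr \<theta>"
    define b where "b = A * ln x - B"
    have x: "x > 1" "ln x > 0" using elim by auto
    have y: "y \<ge> 1" "y \<ge> M" using elim M(1) by (auto simp: y_def)
    have b_eq: "b = totient M / M * (ln (y / M) / n) - totient M / M * ln (1 + 2 * real M)"
    proof -
      have ln: "ln (y / M) = \<theta> * ln x - ln M" using x M(1) by (simp add: y_def ln_div ln_powr)
      moreover have "totient M / M = \<delta>" by (simp add: \<delta>_def M_def)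
      ultimately show ?thesis unfolding b_def A_def B_def ln by (simp add: diff_divide_distrib algebra_simps)
    qed
    have b: "b > 0" using elim by (simp add: b_def)
    have G: "H * (b ^ 3 * K) \<le> selberg_sum 4 y"
      using selberg_sum_ge[of n y, folded M_def, folded b_eq] assms(1) y b by (simp add: H_def K_def)
    have G0: "H * (b ^ 3 * K) > 0" using H K b by simp
    have 1: "(x + 1) / 6 / selberg_sum 4 y \<le> (x + 1) / 6 / (H * (b ^ 3 * K))"
      using x by (intro divide_left_mono mult_pos_pos less_le_trans[OF G0 G] G G0) auto
    have "(\<Sum>S\<in>sieve_sets 4 y. 9 ^ card S) \<le> (\<Sum>S\<in>sieve_sets 4 y. C * y powr \<epsilon>)"
    proof (intro sum_mono)
      fix S assume S: "S \<in> sieve_sets 4 y"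
      have "9 ^ card S \<le> C * real (\<Prod>S) powr \<epsilon>" using sieve_setsD[OF S] by (intro C(2)) auto
      also have "\<dots> \<le> C * y powr \<epsilon>"
        using sieve_setsD(3)[OF S] C(1) \<epsilon> by (intro mult_left_mono powr_mono2) (auto intro: prod_nonneg)
      finally show "9 ^ card S \<le> C * y powr \<epsilon>" .
    qed
    also have "\<dots> = real (card (sieve_sets 4 y)) * (C * y powr \<epsilon>)" by simp
    also have "\<dots> \<le> y * (C * y powr \<epsilon>)"
      using y C(1) by (intro mult_right_mono card_sieve_sets_le) auto
    finally have "(\<Sum>S\<in>sieve_sets 4 y. 9 ^ card S) ^ 2 \<le> (y * (C * y powr \<epsilon>)) ^ 2"
      by (intro power_mono sum_nonneg) auto
    also have "\<dots> = C ^ 2 * (x powr (\<theta> + \<theta> * \<epsilon>)) ^ 2"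
      using x by (simp add: y_def powr_powr powr_add power_mult_distrib)
    also have "(x powr (\<theta> + \<theta> * \<epsilon>)) ^ 2 = x powr (2 * (\<theta> + \<theta> * \<epsilon>))"
      by (simp only: power2_eq_square mult_2 powr_add)
    also have "2 * (\<theta> + \<theta> * \<epsilon>) = 1 - \<epsilon> ^ 2" by (simp add: \<epsilon>_def power2_eq_square algebra_simps)
    finally have 2: "(\<Sum>S\<in>sieve_sets 4 y. 9 ^ card S) ^ 2 \<le> C ^ 2 * x powr (1 - \<epsilon> ^ 2)" .
    have "real (card {p \<in> set_A. real p \<le> x}) \<le> (x + 1) / 6 / (H * (b ^ 3 * K))
       + C ^ 2 * x powr (1 - \<epsilon> ^ 2) + 3 * (log 2 (x + 1) + 1) ^ 2 * (y + 1)"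
      using card_set_A_le[of x y] x y 1 2 by linarith
    then have "real (card {p \<in> set_A. real p \<le> x}) * (ln x ^ 3 / x) \<le> ((x + 1) / 6 / (H * (b ^ 3 * K))
       + C ^ 2 * x powr (1 - \<epsilon> ^ 2) + 3 * (log 2 (x + 1) + 1) ^ 2 * (y + 1)) * (ln x ^ 3 / x)"
      using x by (intro mult_right_mono) auto
    also have "\<dots> = (x + 1) / 6 / (H * (b ^ 3 * K)) * (ln x ^ 3 / x)
       + C ^ 2 * x powr (1 - \<epsilon> ^ 2) * (ln x ^ 3 / x) + 3 * (log 2 (x + 1) + 1) ^ 2 * (y + 1) * (ln x ^ 3 / x)"
      by (simp only: distrib_right)
    also have "\<dots> = rhs x"
      unfolding rhs_def b_def[symmetric] y_def[symmetric] by (simp add: power_divide mult_ac)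
    finally show ?case by simp
  qed
  have lim: "(rhs \<longlongrightarrow> 1 / (6 * H * K) * (1 * (1 / A) ^ 3) + C ^ 2 * 0 + 3 * 0) at_top"
    unfolding rhs_def
  proof (intro tendsto_add tendsto_mult tendsto_power tendsto_const)
    show "((\<lambda>x::real. (x + 1) / x) \<longlongrightarrow> 1) at_top" by real_asymp
    have "((\<lambda>x. ln x / (A * ln x - B)) \<longlongrightarrow> inverse A) at_top" using A by real_asymp
    then show "((\<lambda>x. ln x / (A * ln x - B)) \<longlongrightarrow> 1 / A) at_top" by (simp add: field_simps)
    have "((\<lambda>x. x powr \<kappa> * ln x ^ 3 / x) \<longlongrightarrow> 0) at_top" if "\<kappa> < 1" for \<kappa> :: real
      using that by real_asymp
    then show "((\<lambda>x. x powr (1 - \<epsilon> ^ 2) * ln x ^ 3 / x) \<longlongrightarrow> 0) at_top"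
      using \<epsilon> by simp
    have "((\<lambda>x. (log 2 (x + 1) + 1) ^ 2 * ln x ^ 3 * x powr (\<theta> - 1)) \<longlongrightarrow> 0) at_top"
      "((\<lambda>x::real. (log 2 (x + 1) + 1) ^ 2 * ln x ^ 3 * x powr (- 1)) \<longlongrightarrow> 0) at_top"
      using assms(2,3) by real_asymp+
    then have "((\<lambda>x. (log 2 (x + 1) + 1) ^ 2 * ln x ^ 3 * x powr (\<theta> - 1)
      + (log 2 (x + 1) + 1) ^ 2 * ln x ^ 3 * x powr (- 1)) \<longlongrightarrow> 0) at_top"
      by (rule tendsto_add_zero)
    then show "((\<lambda>x. (log 2 (x + 1) + 1) ^ 2 * (x powr \<theta> + 1) * ln x ^ 3 / x) \<longlongrightarrow> 0) at_top"
    proof (rule Lim_transform_eventually)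
      show "eventually (\<lambda>x. (log 2 (x + 1) + 1) ^ 2 * ln x ^ 3 * x powr (\<theta> - 1)
        + (log 2 (x + 1) + 1) ^ 2 * ln x ^ 3 * x powr (- 1)
        = (log 2 (x + 1) + 1) ^ 2 * (x powr \<theta> + 1) * ln x ^ 3 / x) at_top"
        using eventually_gt_at_top[of 0]
        by eventually_elim (simp add: powr_diff powr_minus field_simps)
    qed
  qed
  have "Limsup at_top (\<lambda>x. ereal (real (card {p \<in> set_A. real p \<le> x}) / (x / (ln x) ^ 3)))
      \<le> Limsup at_top (\<lambda>x. ereal (rhs x))"
    using le by (intro Limsup_mono) simp
  also have "\<dots> = ereal (1 / (6 * H * K) * (1 / A) ^ 3)"
    using lim by (intro lim_imp_Limsup) auto
  finally show ?thesis by (simp add: H_def K_def A_def)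
qed

section \<open>Convergence of the singular series and evaluation of the constant\<close>

text \<open>With u = 1 / p, the linear terms of 1 - 3u and (1 - u)^3 cancel, leaving a difference of
  order u^2. The constant 6 exceeds 3 / (4 / 5)^3 = 375 / 64.\<close>

lemma singular_factor_bounds:
  fixes u :: real
  assumes "0 \<le> u" "u \<le> 1 / 5"
  shows "(1 - 3 * u) * (1 - u) powi (-3) > 0" "\<bar>(1 - 3 * u) * (1 - u) powi (-3) - 1\<bar> \<le> 6 * u ^ 2"
proof -
  have c: "(4 / 5) ^ 3 \<le> (1 - u) ^ 3" using assms by (intro power_mono) auto
  then have pos: "(1 - u) ^ 3 > 0" using assms by auto
  have e: "(1 - 3 * u) * (1 - u) powi (-3) = (1 - 3 * u) / (1 - u) ^ 3"
    by (simp add: power_int_minus divide_inverse)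
  show "(1 - 3 * u) * (1 - u) powi (-3) > 0" unfolding e using pos assms by auto
  have "(1 - 3 * u) / (1 - u) ^ 3 - 1 = - (u ^ 2 * (3 - u) / (1 - u) ^ 3)"
    using pos by (simp add: field_simps power2_eq_square power3_eq_cube)
  moreover have "u ^ 2 * (3 - u) / (1 - u) ^ 3 \<le> u ^ 2 * (3 - u) / (4 / 5) ^ 3"
    using c assms by (intro divide_left_mono) auto
  moreover have "u ^ 2 * (3 - u) / (4 / 5) ^ 3 \<le> 6 * u ^ 2"
  proof -
    have "u ^ 2 * (3 - u) / (4 / 5) ^ 3 \<le> u ^ 2 * 3 / (4 / 5) ^ 3"
      using assms by (intro divide_right_mono mult_left_mono) auto
    also have "\<dots> \<le> 6 * u ^ 2" by (simp add: power3_eq_cube)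
    finally show ?thesis .
  qed
  moreover have "u ^ 2 * (3 - u) / (1 - u) ^ 3 \<ge> 0" using pos assms by auto
  ultimately show "\<bar>(1 - 3 * u) * (1 - u) powi (-3) - 1\<bar> \<le> 6 * u ^ 2" unfolding e by linarith
qed

text \<open>The factors differ from 1 by at most 6 / p^2 and are positive, so the product converges
  and \<open>prodinf\<close> is the limit of the partial products.\<close>

lemma singular_series_A_LIMSEQ:
  "(\<lambda>n. 9 * (\<Prod>p | prime p \<and> 4 < p \<and> p \<le> n. (1 - 3 / real p) * (1 - 1 / real p) powi (-3)))
     \<longlonglongrightarrow> singular_series_A"
proof -
  define f where "f p = (if prime p \<and> p \<ge> 5 then (1 - 3 / real p) * (1 - 1 / real p) powi (-3) else 1)" for p :: nat
  have f: "f p > 0" "norm \<bar>f p - 1\<bar> \<le> 6 * (1 / real p ^ 2)" for p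
  proof -
    have "f p > 0 \<and> \<bar>f p - 1\<bar> \<le> 6 * (1 / real p ^ 2)"
    proof (cases "prime p \<and> p \<ge> 5")
      case True
      then have "0 \<le> 1 / real p" "1 / real p \<le> 1 / 5" by (auto intro: divide_left_mono)
      from singular_factor_bounds[OF this] show ?thesis using True by (simp add: f_def power_divide)
    qed (auto simp: f_def)
    then show "f p > 0" "norm \<bar>f p - 1\<bar> \<le> 6 * (1 / real p ^ 2)" by auto
  qed
  have "summable (\<lambda>p. 6 * (1 / real p ^ 2))"
    using inverse_power_summable[of 2, where ?'a = real] by (intro summable_mult) (simp add: divide_inverse)
  then have "summable (\<lambda>p. \<bar>f p - 1\<bar>)" by (rule summable_comparison_test'[of _ 0]) (use f in auto)
  then have "convergent_prod (\<lambda>p. 1 + (f p - 1))"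
  proof (rule summable_imp_convergent_prod_real)
    show "f p - 1 \<noteq> -1" for p using f(1)[of p] by simp
  qed
  then have "(\<lambda>n. \<Prod>p\<le>n. f p) \<longlonglongrightarrow> prodinf f" using convergent_prod_LIMSEQ[of f] by simp
  moreover have "(\<Prod>p\<le>n. f p) = (\<Prod>p | prime p \<and> 4 < p \<and> p \<le> n. (1 - 3 / real p) * (1 - 1 / real p) powi (-3))" for n
    by (rule prod.mono_neutral_cong_right) (auto simp: f_def)
  ultimately show ?thesis unfolding singular_series_A_def f_def by (intro tendsto_mult_left) simp
qed

text \<open>Euler's formula; the primes 2 and 3 account for the factor 1 / 3 = (1 - 1 / 2)(1 - 1 /
  3), whose cube later produces the 9 in the singular series.\<close>

lemma totient_fact_eq:
  assumes "n \<ge> 4"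
  shows "real (totient (fact n)) / fact n = 1 / 3 * (\<Prod>p | prime p \<and> 4 < p \<and> p \<le> n. 1 - 1 / real p)"
proof -
  define P where "P = {p. prime p \<and> 4 < p \<and> p \<le> n}"
  have fin: "finite P" by (rule finite_subset[of _ "{..n}"]) (auto simp: P_def)
  have "prime_factors (fact n :: nat) = {p. prime p \<and> p \<le> n}"
    by (auto simp: prime_factors_dvd prime_dvd_fact_iff)
  also have "\<dots> = insert 2 (insert 3 P)"
  proof -
    have "p = 2 \<or> p = 3" if "prime p" "\<not> 4 < p" for p :: nat
    proof -
      have "p \<in> {2, 3, 4}" using prime_ge_2_nat[OF that(1)] that(2) by auto
      moreover have "\<not> prime (4::nat)" using prime_product[of 2 2] by auto
      ultimately show ?thesis using that(1) by auto
    qed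
    then show ?thesis using assms by (auto simp: P_def)
  qed
  finally have "real (totient (fact n)) = fact n * ((1 - 1 / 2) * ((1 - 1 / 3) * (\<Prod>p\<in>P. 1 - 1 / real p)))"
    using fin by (subst totient_formula2) (simp add: P_def)
  then show ?thesis by (simp add: P_def)
qed

theorem theorem4p8:
  "Limsup at_top (\<lambda>x :: real. ereal (real (card {p \<in> set_A. real p \<le> x}) / (x / (ln x) ^ 3)))
     \<le> ereal (24 * singular_series_A)"
proof (rule LIMSEQ_le_const)
  \<comment> \<open>Any sequence in (0, 1 / 2) tending to 1 / 2 would serve; the shift by 3 keeps
    every term positive.\<close>
  define \<theta> where "\<theta> n = 1 / 2 - 1 / (real n + 3)" for n
  define S where "S n = 9 * (\<Prod>p | prime p \<and> 4 < p \<and> p \<le> n. (1 - 3 / real p) * (1 - 1 / real p) powi (-3))" for n :: nat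
  define B where "B n = 1 / 2 * (real n ^ 3 / (real n * (real n - 1) * (real n - 2) / 6)) * (1 / \<theta> n) ^ 3 * S n" for n
  \<comment> \<open>The constant 24 is 1 / 2 * 6 * 2^3: the 6 is the limit of n^3 divided by the
    binomial coefficient \<open>n choose 3\<close>, and the 2 is the limit of
    \<open>1 / \<theta> n\<close>.\<close>
  have "B \<longlonglongrightarrow> 1 / 2 * 6 * 2 ^ 3 * singular_series_A"
    unfolding B_def
  proof (intro tendsto_intros)
    show "(\<lambda>n. real n ^ 3 / (real n * (real n - 1) * (real n - 2) / 6)) \<longlonglongrightarrow> 6" by real_asymp
    show "(\<lambda>n. 1 / \<theta> n) \<longlonglongrightarrow> 2" unfolding \<theta>_def by real_asymp
    show "S \<longlonglongrightarrow> singular_series_A" unfolding S_def by (rule singular_series_A_LIMSEQ)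
  qed
  then show "(\<lambda>n. ereal (B n)) \<longlonglongrightarrow> ereal (24 * singular_series_A)" by simp
  have "Limsup at_top (\<lambda>x :: real. ereal (real (card {p \<in> set_A. real p \<le> x}) / (x / (ln x) ^ 3))) \<le> ereal (B n)"
    if n: "n \<ge> 4" for n
  proof -
    define P where "P = {p. prime p \<and> 4 < p \<and> p \<le> n}"
    define H where "H = (\<Prod>p\<in>P. 1 - 3 / real p)"
    define D where "D = (\<Prod>p\<in>P. 1 - 1 / real p)"
    have \<theta>: "0 < \<theta> n" "\<theta> n < 1 / 2" using n by (auto simp: \<theta>_def field_simps)
    have H: "(\<Prod>p\<in>P. 1 / (1 - 3 / real p)) = 1 / H" by (simp add: H_def prod_dividef)
    have D: "real (totient (fact n)) / fact n = D / 3"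
      using totient_fact_eq[OF n] by (simp add: D_def P_def)
    have S: "S n = 9 * H / D ^ 3"
      unfolding S_def P_def[symmetric]
      by (simp add: H_def D_def power_int_minus prod_dividef prod_power_distrib flip: divide_inverse)
    have choose: "real (n choose 3) = real n * (real n - 1) * (real n - 2) / 6"
      by (simp add: binomial_gbinomial gbinomial_prod_rev numeral_3_eq_3 fact_numeral algebra_simps)
    \<comment> \<open>The cube of 3 from \<open>D / 3\<close> over the 6 from the residue class
      gives 27 / 6 = 9 / 2, which splits into the factor 1 / 2 of \<open>B\<close> and the 9 of
      \<open>S\<close>.\<close>
    have "B n = 1 / (6 * (1 / H) * real (n choose 3)) * (1 / (D / 3 * \<theta> n / n)) ^ 3"
      unfolding B_def S choose[symmetric] using n by (simp add: power_divide power_mult_distrib mult_ac)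
    then show ?thesis using Limsup_set_A_le[OF n \<theta>] by (simp add: H D P_def[symmetric])
  qed
  then show "\<exists>N. \<forall>n\<ge>N. Limsup at_top (\<lambda>x :: real. ereal (real (card {p \<in> set_A. real p \<le> x}) / (x / (ln x) ^ 3))) \<le> ereal (B n)"
    by blast
qed

end
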